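(* Let $E$ be a semi-reflexive metrizable barrelled locally convex space, let $F$ be a Hausdorff reflexive locally convex space, and let $E^*$ and $F^*$ be the strong duals of $E$ and $F$ respectively. Then every continuous linear operator $T$ of $E^*$ onto $F^*$ is open.
   Context: A barrel in a locally convex space is an absolutely convex, absorbent, closed set; a locally convex space is barrelled if every barrel is a neighbourhood of $0$. The strong dual $E^*$ is the space of continuous linear functionals on $E$ with the topology of uniform convergence on bounded subsets of $E$. $E$ is semi-reflexive if the canonical map from $E$ into the dual of the strong dual $E^*$ is surjective, and $E$ is reflexive if this map is a topological isomorphism onto the strong bidual. *)

theory Defs
  imports "HOL-Analysis.Analysis" "HOL-Library.Function_Algebras"
begin

text \<open>
  The scalar field is any type \<open>'k :: {real_normed_field, euclidean_space}\<close>. By the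
  Gelfand-Mazur theorem such a field is isometrically isomorphic to the real or the complex
  numbers, and both types are instances of the sort, so one development covers the two cases.

  A space is given by a scalar multiplication \<open>s\<close> on an ambient vector space and by an abstract
  topology \<open>X\<close>; its underlying vector space is \<open>topspace X\<close>, a linear subspace of the ambient
  space. With this convention the strong dual is again such a pair, so that it can be dualised
  once more.
\<close>

definition linear_map_on ::
  "('k::field \<Rightarrow> 'a::ab_group_add \<Rightarrow> 'a) \<Rightarrow> ('k \<Rightarrow> 'b::ab_group_add \<Rightarrow> 'b) \<Rightarrow> 'a set \<Rightarrow> ('a \<Rightarrow> 'b) \<Rightarrow> bool"
  where "linear_map_on s t V f \<longleftrightarrow>
    (\<forall>x\<in>V. \<forall>y\<in>V. f (x + y) = f x + f y) \<and> (\<forall>c. \<forall>x\<in>V. f (s c x) = t c (f x))"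

definition convex_set ::
  "('k::{real_normed_field, euclidean_space} \<Rightarrow> 'a::ab_group_add \<Rightarrow> 'a) \<Rightarrow> 'a set \<Rightarrow> bool"
  where "convex_set s C \<longleftrightarrow>
    (\<forall>x\<in>C. \<forall>y\<in>C. \<forall>t::real. 0 \<le> t \<and> t \<le> 1 \<longrightarrow> s (of_real (1 - t)) x + s (of_real t) y \<in> C)"

definition absolutely_convex ::
  "('k::{real_normed_field, euclidean_space} \<Rightarrow> 'a::ab_group_add \<Rightarrow> 'a) \<Rightarrow> 'a set \<Rightarrow> bool"
  where "absolutely_convex s A \<longleftrightarrow>
    (\<forall>x\<in>A. \<forall>y\<in>A. \<forall>a b. norm a + norm b \<le> 1 \<longrightarrow> s a x + s b y \<in> A)"

definition absorbs ::
  "('k::{real_normed_field, euclidean_space} \<Rightarrow> 'a::ab_group_add \<Rightarrow> 'a) \<Rightarrow> 'a set \<Rightarrow> 'a set \<Rightarrow> bool"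
  where "absorbs s A B \<longleftrightarrow> (\<exists>r>0. \<forall>c. r \<le> norm c \<longrightarrow> B \<subseteq> s c ` A)"

definition absorbent ::
  "('k::{real_normed_field, euclidean_space} \<Rightarrow> 'a::ab_group_add \<Rightarrow> 'a) \<Rightarrow> 'a topology \<Rightarrow> 'a set \<Rightarrow> bool"
  where "absorbent s X A \<longleftrightarrow> (\<forall>x\<in>topspace X. absorbs s A {x})"

definition locally_convex_space ::
  "('k::{real_normed_field, euclidean_space} \<Rightarrow> 'a::ab_group_add \<Rightarrow> 'a) \<Rightarrow> 'a topology \<Rightarrow> bool"
  where "locally_convex_space s X \<longleftrightarrow>
    vector_space s \<and> module.subspace s (topspace X) \<and>
    continuous_map (prod_topology X X) X (\<lambda>(x, y). x + y) \<and>
    continuous_map (prod_topology euclidean X) X (\<lambda>(c, x). s c x) \<and>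
    neighbourhood_base_at 0 (convex_set s) X"

definition barrel ::
  "('k::{real_normed_field, euclidean_space} \<Rightarrow> 'a::ab_group_add \<Rightarrow> 'a) \<Rightarrow> 'a topology \<Rightarrow> 'a set \<Rightarrow> bool"
  where "barrel s X B \<longleftrightarrow> absolutely_convex s B \<and> absorbent s X B \<and> closedin X B"

text \<open>A set \<open>U\<close> is a neighbourhood of \<open>0\<close> iff \<open>0 \<in> X interior_of U\<close>.\<close>

definition barrelled ::
  "('k::{real_normed_field, euclidean_space} \<Rightarrow> 'a::ab_group_add \<Rightarrow> 'a) \<Rightarrow> 'a topology \<Rightarrow> bool"
  where "barrelled s X \<longleftrightarrow>
    locally_convex_space s X \<and> (\<forall>B. barrel s X B \<longrightarrow> 0 \<in> X interior_of B)"

definition bounded_in ::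
  "('k::{real_normed_field, euclidean_space} \<Rightarrow> 'a::ab_group_add \<Rightarrow> 'a) \<Rightarrow> 'a topology \<Rightarrow> 'a set \<Rightarrow> bool"
  where "bounded_in s X B \<longleftrightarrow>
    B \<subseteq> topspace X \<and> (\<forall>U. 0 \<in> X interior_of U \<longrightarrow> absorbs s U B)"

text \<open>
  Functionals are represented by functions on the ambient type vanishing outside \<open>topspace X\<close>,
  so that equal functionals are equal as functions; they form a linear subspace under the
  pointwise operations.
\<close>

definition fun_scale :: "'k::field \<Rightarrow> ('a \<Rightarrow> 'k) \<Rightarrow> ('a \<Rightarrow> 'k)"
  where "fun_scale c f = (\<lambda>x. c * f x)"

definition continuous_dual ::
  "('k::{real_normed_field, euclidean_space} \<Rightarrow> 'a::ab_group_add \<Rightarrow> 'a) \<Rightarrow> 'a topology \<Rightarrow> ('a \<Rightarrow> 'k) set"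
  where "continuous_dual s X =
    {f. linear_map_on s (*) (topspace X) f \<and> continuous_map X euclidean f \<and>
        (\<forall>x. x \<notin> topspace X \<longrightarrow> f x = 0)}"

definition strong_dual ::
  "('k::{real_normed_field, euclidean_space} \<Rightarrow> 'a::ab_group_add \<Rightarrow> 'a) \<Rightarrow> 'a topology \<Rightarrow> ('a \<Rightarrow> 'k) topology"
  where "strong_dual s X = topology (\<lambda>U. U \<subseteq> continuous_dual s X \<and>
    (\<forall>f\<in>U. \<exists>B e. bounded_in s X B \<and> 0 < e \<and>
      {g \<in> continuous_dual s X. \<forall>x\<in>B. norm (g x - f x) < e} \<subseteq> U))"

definition canonical_map ::
  "('k::{real_normed_field, euclidean_space} \<Rightarrow> 'a::ab_group_add \<Rightarrow> 'a) \<Rightarrow> 'a topology \<Rightarrow> 'a \<Rightarrow> (('a \<Rightarrow> 'k) \<Rightarrow> 'k)"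
  where "canonical_map s X x = (\<lambda>f. if f \<in> continuous_dual s X then f x else 0)"

definition semi_reflexive ::
  "('k::{real_normed_field, euclidean_space} \<Rightarrow> 'a::ab_group_add \<Rightarrow> 'a) \<Rightarrow> 'a topology \<Rightarrow> bool"
  where "semi_reflexive s X \<longleftrightarrow>
    canonical_map s X ` topspace X = continuous_dual fun_scale (strong_dual s X)"

text \<open>The canonical map is always linear, so being a topological isomorphism amounts to being a
  homeomorphism.\<close>

definition reflexive ::
  "('k::{real_normed_field, euclidean_space} \<Rightarrow> 'a::ab_group_add \<Rightarrow> 'a) \<Rightarrow> 'a topology \<Rightarrow> bool"
  where "reflexive s X \<longleftrightarrow>
    homeomorphic_map X (strong_dual fun_scale (strong_dual s X)) (canonical_map s X)"

text \<open>The predicate used in \<^const>\<open>strong_dual\<close> is a topology, so the definition is not vacuous.\<close>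

lemma absorbs_Un:
  assumes "absorbs s U B" "absorbs s U C"
  shows "absorbs s U (B \<union> C)"
proof -
  obtain r1 r2 where "r1 > 0" "\<forall>c. r1 \<le> norm c \<longrightarrow> B \<subseteq> s c ` U"
    "r2 > 0" "\<forall>c. r2 \<le> norm c \<longrightarrow> C \<subseteq> s c ` U"
    using assms unfolding absorbs_def by blast
  then show ?thesis
    unfolding absorbs_def by (intro exI[of _ "max r1 r2"]) auto
qed

lemma bounded_in_Un:
  "bounded_in s X B \<Longrightarrow> bounded_in s X C \<Longrightarrow> bounded_in s X (B \<union> C)"
  by (simp add: bounded_in_def absorbs_Un)

lemma bounded_in_empty: "bounded_in s X {}"
  unfolding bounded_in_def absorbs_def by (auto intro: exI[of _ 1])

lemma openin_strong_dual:
  "openin (strong_dual s X) U \<longleftrightarrow> U \<subseteq> continuous_dual s X \<and>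
    (\<forall>f\<in>U. \<exists>B e. bounded_in s X B \<and> 0 < e \<and>
      {g \<in> continuous_dual s X. \<forall>x\<in>B. norm (g x - f x) < e} \<subseteq> U)"
proof -
  let ?N = "\<lambda>f B e. {g \<in> continuous_dual s X. \<forall>x\<in>B. norm (g x - f x) < e}"
  let ?P = "\<lambda>U. U \<subseteq> continuous_dual s X \<and>
    (\<forall>f\<in>U. \<exists>B e. bounded_in s X B \<and> 0 < e \<and> ?N f B e \<subseteq> U)"
  have "?P (S \<inter> T)" if S: "?P S" and T: "?P T" for S T
  proof (intro conjI ballI)
    show "S \<inter> T \<subseteq> continuous_dual s X" using S by blast
    fix f assume f: "f \<in> S \<inter> T"
    obtain B1 e1 where 1: "bounded_in s X B1" "0 < e1" "?N f B1 e1 \<subseteq> S"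
      using S f by blast
    obtain B2 e2 where 2: "bounded_in s X B2" "0 < e2" "?N f B2 e2 \<subseteq> T"
      using T f by blast
    have "?N f (B1 \<union> B2) (min e1 e2) \<subseteq> ?N f B1 e1 \<inter> ?N f B2 e2"
      by auto
    then have "?N f (B1 \<union> B2) (min e1 e2) \<subseteq> S \<inter> T"
      using 1(3) 2(3) by blast
    moreover have "bounded_in s X (B1 \<union> B2)" "0 < min e1 e2"
      using 1 2 bounded_in_Un by auto
    ultimately show "\<exists>B e. bounded_in s X B \<and> 0 < e \<and> ?N f B e \<subseteq> S \<inter> T"
      by blast
  qed
  moreover have "?P (\<Union>\<K>)" if K: "\<forall>K\<in>\<K>. ?P K" for \<K>
  proof (intro conjI ballI)
    show "\<Union>\<K> \<subseteq> continuous_dual s X" using K by blast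
    fix f assume "f \<in> \<Union>\<K>"
    then obtain K where "K \<in> \<K>" "f \<in> K" by blast
    moreover then obtain B e where "bounded_in s X B" "0 < e" "?N f B e \<subseteq> K"
      using K by blast
    ultimately show "\<exists>B e. bounded_in s X B \<and> 0 < e \<and> ?N f B e \<subseteq> \<Union>\<K>"
      by blast
  qed
  ultimately have "istopology ?P"
    unfolding istopology_def by blast
  then show ?thesis
    unfolding strong_dual_def by (simp add: topology_inverse')
qed

lemma topspace_strong_dual [simp]: "topspace (strong_dual s X) = continuous_dual s X"
proof -
  have "openin (strong_dual s X) (continuous_dual s X)"
    unfolding openin_strong_dual using bounded_in_empty[of s X]
    by (auto intro!: exI[of _ "{}"] exI[of _ "1::real"])
  then show ?thesis
    by (meson openin_strong_dual openin_subset openin_topspace subset_antisym)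
qed

end

theory Submission
  imports Defs
begin

text \<open>
  Openness of \<open>T\<close> is a lifting problem: for a bounded set \<open>B\<close> in \<open>E\<close> with polar \<open>P\<close> in \<open>E\<^sup>*\<close>, the
  image \<open>T P\<close> must contain a multiple of the polar of some bounded set of \<open>F\<close>. The bounded set is
  \<open>D = {y. \<bar>T f y\<bar> \<le> 1 for all f \<in> P}\<close>, the preimage of the bipolar of \<open>B\<close> under the transpose
  of \<open>T\<close>. Since \<open>T\<close> is onto, every functional on \<open>F\<close> is some \<open>T f\<close> and hence bounded on \<open>D\<close>, so
  Mackey's theorem (\<open>weakly_bounded_imp_bounded_in\<close>) makes \<open>D\<close> bounded.

  Let \<open>g\<close> be in the polar of \<open>D\<close> and \<open>g = T f\<close>. The lifting (\<open>polar_lift\<close>) asks for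
  \<open>f / 2 \<in> ker T + P\<close>. This set is an absolutely convex neighbourhood of \<open>0\<close> in \<open>E\<^sup>*\<close>; if it missed
  \<open>f / 2\<close>, the Hahn-Banach theorem would give a functional on \<open>E\<^sup>*\<close> that is at most \<open>1\<close> on it and at
  least \<open>1\<close> at \<open>f / 2\<close>. By semi-reflexivity this functional is evaluation at a point \<open>x\<close> of \<open>E\<close>,
  and it vanishes on \<open>ker T\<close>. If \<open>x\<close> corresponds to a point \<open>y\<close> of \<open>F\<close>, that is, \<open>h x = T h y\<close> for
  all \<open>h\<close>, then \<open>y \<in> D\<close>, so \<open>\<bar>f x\<bar> = \<bar>g y\<bar> \<le> 1\<close>, against \<open>\<bar>f x\<bar> \<ge> 2\<close>.

  It remains that the points of \<open>E\<close> annihilated by \<open>ker T\<close> come from \<open>F\<close>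
  (\<open>annihilator_kernel_in_transpose_range\<close>), which says that the transpose of \<open>T\<close> has closed range;
  here metrizability enters. Such an \<open>x\<close> lies in the closure of the range by Hahn-Banach, so it is
  the limit of a sequence \<open>z n\<close> in the range, with corresponding \<open>y n\<close> in \<open>F\<close>. The sequence \<open>y n\<close>
  is weakly bounded, hence bounded, and \<open>T h \<mapsto> h x\<close> is a functional on \<open>F\<^sup>*\<close> which is bounded on the
  polar of \<open>{y n}\<close>. Semi-reflexivity of \<open>F\<close> represents it by the desired \<open>y\<close>.
\<close>

section \<open>The Hahn-Banach theorem for seminorms\<close>

definition sublinear_on ::
  "(real \<Rightarrow> 'a::ab_group_add \<Rightarrow> 'a) \<Rightarrow> 'a set \<Rightarrow> ('a \<Rightarrow> real) \<Rightarrow> bool"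
  where "sublinear_on r V q \<longleftrightarrow>
    (\<forall>x\<in>V. \<forall>y\<in>V. q (x + y) \<le> q x + q y) \<and> (\<forall>t\<ge>0. \<forall>x\<in>V. q (r t x) = t * q x)"

lemma sublinear_onD:
  assumes "sublinear_on r V q"
  shows "\<And>x y. x \<in> V \<Longrightarrow> y \<in> V \<Longrightarrow> q (x + y) \<le> q x + q y"
    and "\<And>t x. 0 \<le> t \<Longrightarrow> x \<in> V \<Longrightarrow> q (r t x) = t * q x"
  using assms by (auto simp: sublinear_on_def)

lemma sublinear_on_zero:
  assumes "vector_space r" "module.subspace r V" "sublinear_on r V q"
  shows "q 0 = 0"
proof -
  interpret vector_space r by fact
  show ?thesis
    using sublinear_onD(2)[OF assms(3), of 0 0] subspace_0[OF assms(2)] by simp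
qed

lemma sublinear_on_minus:
  assumes "vector_space r" "module.subspace r V" "sublinear_on r V q" "x \<in> V"
  shows "- q (- x) \<le> q x"
proof -
  interpret vector_space r by fact
  have "q (x + - x) \<le> q x + q (- x)"
    using sublinear_onD(1)[OF assms(3)] assms(2,4) subspace_neg by blast
  then show ?thesis using sublinear_on_zero[OF assms(1-3)] by simp
qed

text \<open>
  Replacing \<open>q y\<close> by the infimum over \<open>t \<ge> 0\<close> of \<open>q (y + t x) - t * q x\<close> keeps it sublinear and makes
  it smaller, unless \<open>q\<close> is already additive in the direction \<open>x\<close>; so minimal sublinear
  functionals are linear. The value \<open>0\<close> outside \<open>V\<close> makes the pointwise order antisymmetric.
\<close>

lemma sublinear_lower_along:
  assumes "vector_space r" "module.subspace r V" "sublinear_on r V q" and x: "x \<in> V"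
  obtains q' where "sublinear_on r V q'" "\<And>y. y \<in> V \<Longrightarrow> q' y \<le> q y"
    "\<And>y. y \<in> V \<Longrightarrow> q' y \<le> q (y + x) - q x" "\<And>y. y \<notin> V \<Longrightarrow> q' y = 0"
proof -
  interpret vector_space r by fact
  note sub = assms(2) and q = sublinear_onD[OF assms(3)]
  have V: "\<And>u v. u \<in> V \<Longrightarrow> v \<in> V \<Longrightarrow> u + v \<in> V" "\<And>t u. u \<in> V \<Longrightarrow> r t u \<in> V"
    "\<And>u. u \<in> V \<Longrightarrow> - u \<in> V"
    using sub subspace_add subspace_scale subspace_neg by auto
  define S where "S y = (\<lambda>t. q (y + r t x) - t * q x) ` {0..}" for y
  define q' where "q' y = (if y \<in> V then Inf (S y) else 0)" for y
  have bdd: "bdd_below (S y)" if y: "y \<in> V" for y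
  proof (rule bdd_belowI)
    fix v assume "v \<in> S y"
    then obtain t where t: "t \<ge> 0" "v = q (y + r t x) - t * q x" by (auto simp: S_def)
    have "q (r t x) \<le> q (y + r t x) + q (- y)"
      using q(1)[of "y + r t x" "- y"] V x y by simp
    then show "- q (- y) \<le> v" using t q(2)[OF t(1) x] by simp
  qed
  have le: "q' y \<le> q (y + r t x) - t * q x" if "y \<in> V" "t \<ge> 0" for y t
    unfolding q'_def using that bdd by (auto intro!: cInf_lower simp: S_def)
  have ge: "c \<le> q' y" if "y \<in> V" "\<And>t. t \<ge> 0 \<Longrightarrow> c \<le> q (y + r t x) - t * q x" for c y
    unfolding q'_def using that by (auto intro!: cInf_greatest simp: S_def)
  have add: "q' (y + z) \<le> q' y + q' z" if y: "y \<in> V" and z: "z \<in> V" for y z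
  proof -
    have "q' (y + z) - (q (z + r u x) - u * q x) \<le> q (y + r t x) - t * q x"
      if "t \<ge> 0" "u \<ge> 0" for t u
    proof -
      have "q' (y + z) \<le> q ((y + r t x) + (z + r u x)) - (t + u) * q x"
        using le[of "y + z" "t + u"] that V y z by (simp add: scale_left_distrib algebra_simps)
      also have "\<dots> \<le> q (y + r t x) + q (z + r u x) - (t + u) * q x"
        using q(1) V x y z by simp
      finally show ?thesis by (simp add: algebra_simps)
    qed
    then have "q' (y + z) - (q (z + r u x) - u * q x) \<le> q' y" if "u \<ge> 0" for u
      using ge[OF y] that by blast
    then have "q' (y + z) - q' y \<le> q' z"
      by (intro ge[OF z]) (smt (verit))
    then show ?thesis by simp
  qed
  have zero: "q' 0 = 0"
  proof (rule antisym)
    show "q' 0 \<le> 0"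
      using le[of 0 0] subspace_0[OF sub] sublinear_on_zero[OF assms(1-3)] by simp
    show "0 \<le> q' 0"
      using ge[of 0 0] subspace_0[OF sub] q(2) x by simp
  qed
  have scale_le: "q' (r t y) \<le> t * q' y" if t: "t > 0" and y: "y \<in> V" for t y
  proof -
    have "q' (r t y) / t \<le> q' y"
    proof (rule ge[OF y])
      fix u :: real assume u: "u \<ge> 0"
      have "q' (r t y) \<le> q (r t y + r (t * u) x) - (t * u) * q x"
        using le[of "r t y" "t * u"] t u y V by simp
      also have "r t y + r (t * u) x = r t (y + r u x)"
        by (simp add: scale_right_distrib)
      also have "q (r t (y + r u x)) = t * q (y + r u x)"
        using q(2) t V x y by simp
      finally show "q' (r t y) / t \<le> q (y + r u x) - u * q x"
        using t by (simp add: field_simps)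
    qed
    then show ?thesis using t by (simp add: field_simps)
  qed
  have "q' (r t y) = t * q' y" if t: "t \<ge> 0" and y: "y \<in> V" for t y
  proof (cases "t = 0")
    case True then show ?thesis using zero by simp
  next
    case False
    with t have t: "t > 0" by simp
    have "q' (r (1 / t) (r t y)) \<le> (1 / t) * q' (r t y)"
      using scale_le[of "1 / t" "r t y"] t V y by simp
    then have "t * q' y \<le> q' (r t y)" using t by (simp add: field_simps)
    with scale_le[OF t y] show ?thesis by simp
  qed
  then have "sublinear_on r V q'" using add by (auto simp: sublinear_on_def)
  moreover have "q' y \<le> q y" if "y \<in> V" for y using le[OF that, of 0] by simp
  moreover have "q' y \<le> q (y + x) - q x" if "y \<in> V" for y using le[OF that, of 1] by simp
  moreover have "q' y = 0" if "y \<notin> V" for y using that by (simp add: q'_def)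
  ultimately show thesis using that by blast
qed

text \<open>
  The lower bounds that Zorn's lemma asks for. The common bound \<open>p\<close> keeps the infimum finite,
  because \<open>q x \<ge> - q (- x) \<ge> - p (- x)\<close>.
\<close>

lemma sublinear_on_Inf_chain:
  assumes vs: "vector_space r" "module.subspace r V" and C: "C \<noteq> {}"
    "\<And>q. q \<in> C \<Longrightarrow> sublinear_on r V q" "\<And>q. q \<in> C \<Longrightarrow> \<forall>x\<in>V. q x \<le> p x"
    and chain: "\<And>q1 q2. q1 \<in> C \<Longrightarrow> q2 \<in> C \<Longrightarrow> (\<forall>x. q1 x \<le> q2 x) \<or> (\<forall>x. q2 x \<le> q1 x)"
  shows "sublinear_on r V (\<lambda>x. INF q\<in>C. q x)"
    and "\<And>q x. q \<in> C \<Longrightarrow> x \<in> V \<Longrightarrow> (INF q\<in>C. q x) \<le> q x"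
proof -
  interpret vector_space r by fact
  have V: "\<And>u v. u \<in> V \<Longrightarrow> v \<in> V \<Longrightarrow> u + v \<in> V" "\<And>t u. u \<in> V \<Longrightarrow> r t u \<in> V"
    "\<And>u. u \<in> V \<Longrightarrow> - u \<in> V"
    using vs(2) subspace_add subspace_scale subspace_neg by auto
  have bdd: "bdd_below ((\<lambda>q. q x) ` C)" if x: "x \<in> V" for x
  proof (rule bdd_belowI2)
    fix q assume q: "q \<in> C"
    have "- q (- x) \<le> q x" using sublinear_on_minus[OF vs C(2)[OF q] x] .
    moreover have "q (- x) \<le> p (- x)" using C(3)[OF q] V x by blast
    ultimately show "- p (- x) \<le> q x" by simp
  qed
  show le: "(INF q\<in>C. q x) \<le> q x" if "q \<in> C" "x \<in> V" for q x
    using that bdd by (intro cINF_lower) auto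
  have add: "(INF q\<in>C. q (x + y)) \<le> (INF q\<in>C. q x) + (INF q\<in>C. q y)"
    if x: "x \<in> V" and y: "y \<in> V" for x y
  proof -
    have *: "(INF q\<in>C. q (x + y)) \<le> q1 x + q2 y" if q: "q1 \<in> C" "q2 \<in> C" for q1 q2
    proof -
      obtain q where "q \<in> C" "q x \<le> q1 x" "q y \<le> q2 y"
        using chain[OF q] q by blast
      moreover have "q (x + y) \<le> q x + q y"
        using sublinear_onD(1)[OF C(2)] x y \<open>q \<in> C\<close> by blast
      ultimately show ?thesis using le[of q "x + y"] V x y by fastforce
    qed
    have "(INF q\<in>C. q (x + y)) - q2 y \<le> (INF q\<in>C. q x)" if "q2 \<in> C" for q2
      using C(1) *[OF _ that] by (intro cINF_greatest) (auto simp: algebra_simps)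
    then have "(INF q\<in>C. q (x + y)) - (INF q\<in>C. q x) \<le> (INF q\<in>C. q y)"
      using C(1) by (intro cINF_greatest) (auto simp: algebra_simps)
    then show ?thesis by simp
  qed
  have scale: "(INF q\<in>C. q (r t x)) = t * (INF q\<in>C. q x)" if t: "t \<ge> 0" and x: "x \<in> V" for t x
  proof (cases "t = 0")
    case True
    have "(\<lambda>q. q 0) ` C = (\<lambda>q. 0) ` C" using sublinear_on_zero[OF vs C(2)] by (intro image_cong) auto
    then have "(\<lambda>q. q 0) ` C = {0}" using C(1) by auto
    then have "Inf ((\<lambda>q. q 0) ` C) = 0" by (metis cInf_singleton)
    then show ?thesis using True by simp
  next
    case False
    with t have t: "t > 0" by simp
    show ?thesis
    proof (rule antisym)
      have "(INF q\<in>C. q (r t x)) / t \<le> (INF q\<in>C. q x)"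
      proof (intro cINF_greatest C(1))
        fix q assume q: "q \<in> C"
        have "(INF q\<in>C. q (r t x)) \<le> q (r t x)" using le q V x by blast
        also have "\<dots> = t * q x" using sublinear_onD(2)[OF C(2)[OF q]] t x by simp
        finally show "(INF q\<in>C. q (r t x)) / t \<le> q x" using t by (simp add: field_simps)
      qed
      then show "(INF q\<in>C. q (r t x)) \<le> t * (INF q\<in>C. q x)" using t by (simp add: field_simps)
      show "t * (INF q\<in>C. q x) \<le> (INF q\<in>C. q (r t x))"
      proof (intro cINF_greatest C(1))
        fix q assume q: "q \<in> C"
        have "q (r t x) = t * q x" using sublinear_onD(2)[OF C(2)[OF q]] t x by simp
        then show "t * (INF q\<in>C. q x) \<le> q (r t x)" using le[OF q x] t by simp
      qed
    qed
  qed
  show "sublinear_on r V (\<lambda>x. INF q\<in>C. q x)"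
    using add scale by (auto simp: sublinear_on_def)
qed

text \<open>
  A minimal sublinear functional below \<open>p\<close> is linear by
  \<open>sublinear_lower_along\<close>, and Zorn's lemma provides one. To get \<open>f x0 = p x0\<close>, \<open>p\<close> is first lowered along \<open>x0\<close> to \<open>p'\<close>, which
  satisfies \<open>p' (- x0) \<le> - p x0\<close>.
\<close>

lemma Hahn_Banach_sublinear:
  fixes r :: "real \<Rightarrow> 'a::ab_group_add \<Rightarrow> 'a"
  assumes vs: "vector_space r" "module.subspace r V" and p: "sublinear_on r V p" and x0: "x0 \<in> V"
  obtains f where "linear_map_on r (*) V f" "\<And>x. x \<in> V \<Longrightarrow> f x \<le> p x" "f x0 = p x0"
proof -
  interpret vector_space r by fact
  have V: "\<And>u v. u \<in> V \<Longrightarrow> v \<in> V \<Longrightarrow> u + v \<in> V" "\<And>t u. u \<in> V \<Longrightarrow> r t u \<in> V"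
    "\<And>u. u \<in> V \<Longrightarrow> - u \<in> V"
    using vs(2) subspace_add subspace_scale subspace_neg by auto
  obtain p' where p': "sublinear_on r V p'" "\<And>y. y \<in> V \<Longrightarrow> p' y \<le> p y"
    "\<And>y. y \<in> V \<Longrightarrow> p' y \<le> p (y + x0) - p x0" "\<And>y. y \<notin> V \<Longrightarrow> p' y = 0"
    using sublinear_lower_along[OF vs p x0] by metis
  define A where "A = {q. sublinear_on r V q \<and> (\<forall>x\<in>V. q x \<le> p' x) \<and> (\<forall>x. x \<notin> V \<longrightarrow> q x = 0)}"
  define P where "P = (\<lambda>f g :: 'a \<Rightarrow> real. \<forall>x. g x \<le> f x)"
  have "\<exists>m\<in>A. \<forall>a\<in>A. P m a \<longrightarrow> a = m"
  proof (rule predicate_Zorn)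
    show "partial_order_on A (relation_of P A)"
      by (rule partial_order_on_relation_ofI) (auto simp: P_def fun_eq_iff intro: order_trans antisym)
    fix C assume "C \<in> Chains (relation_of P A)"
    then have CA: "C \<subseteq> A" and chain: "\<And>a b. a \<in> C \<Longrightarrow> b \<in> C \<Longrightarrow> P a b \<or> P b a"
      by (auto simp: Chains_def relation_of_def)
    show "\<exists>u\<in>A. \<forall>a\<in>C. P a u"
    proof (cases "C = {}")
      case True
      then show ?thesis using p' by (auto simp: A_def)
    next
      case False
      define u where "u x = (INF q\<in>C. q x)" for x
      have C: "sublinear_on r V q" "\<forall>x\<in>V. q x \<le> p' x" "\<And>x. x \<notin> V \<Longrightarrow> q x = 0" if "q \<in> C" for q
        using CA that by (auto simp: A_def)
      have ch: "(\<forall>x. q1 x \<le> q2 x) \<or> (\<forall>x. q2 x \<le> q1 x)" if "q1 \<in> C" "q2 \<in> C" for q1 q2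
        using chain[OF that] by (auto simp: P_def)
      have u1: "sublinear_on r V u"
        unfolding u_def by (rule sublinear_on_Inf_chain(1)[OF vs False C(1,2) ch])
      have u2: "u x \<le> q x" if "q \<in> C" "x \<in> V" for q x
        unfolding u_def by (rule sublinear_on_Inf_chain(2)[OF vs False C(1,2) ch that])
      have u3: "u x = 0" if "x \<notin> V" for x
      proof -
        have "(\<lambda>q. q x) ` C = (\<lambda>q. 0) ` C" using C(3) that by (intro image_cong) auto
        then have "(\<lambda>q. q x) ` C = {0}" using False by auto
        then show ?thesis by (simp add: u_def)
      qed
      have "u \<in> A"
        using u1 u2 u3 C(2) False unfolding A_def by (fastforce intro: order_trans)
      moreover have "P q u" if "q \<in> C" for q
        unfolding P_def using u2[OF that] u3 C(3)[OF that] by (metis order_refl)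
      ultimately show ?thesis by blast
    qed
  qed
  then obtain f where f: "f \<in> A" and min: "\<And>q. q \<in> A \<Longrightarrow> P f q \<Longrightarrow> q = f" by blast
  have fsub: "sublinear_on r V f" and fle: "\<And>x. x \<in> V \<Longrightarrow> f x \<le> p' x"
    and f0: "\<And>x. x \<notin> V \<Longrightarrow> f x = 0"
    using f by (auto simp: A_def)
  have add: "f (y + x) = f y + f x" if x: "x \<in> V" and y: "y \<in> V" for x y
  proof (rule antisym)
    show "f (y + x) \<le> f y + f x" using sublinear_onD(1)[OF fsub] x y by blast
    obtain q where q: "sublinear_on r V q" "\<And>y. y \<in> V \<Longrightarrow> q y \<le> f y"
      "\<And>y. y \<in> V \<Longrightarrow> q y \<le> f (y + x) - f x" "\<And>y. y \<notin> V \<Longrightarrow> q y = 0"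
      using sublinear_lower_along[OF vs fsub x] by metis
    have "q \<in> A" using q fle unfolding A_def by (fastforce intro: order_trans)
    moreover have "P f q" unfolding P_def using q(2,4) f0 by (metis order_refl)
    ultimately have "q = f" by (rule min)
    then show "f y + f x \<le> f (y + x)" using q(3)[OF y] by simp
  qed
  have zero: "f 0 = 0" by (rule sublinear_on_zero[OF vs fsub])
  have neg: "f (- x) = - f x" if "x \<in> V" for x
    using add[of "- x" x] V that zero by simp
  have scale: "f (r t x) = t * f x" if x: "x \<in> V" for t x
  proof (cases "t \<ge> 0")
    case True then show ?thesis using sublinear_onD(2)[OF fsub] x by blast
  next
    case False
    then have "f (r (- t) x) = - t * f x" by (intro sublinear_onD(2)[OF fsub _ x]) simp
    moreover have "r (- t) x = - r t x" by simp
    ultimately show ?thesis using neg[of "r t x"] V x by simp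
  qed
  have "linear_map_on r (*) V f" using add scale by (auto simp: linear_map_on_def)
  moreover have le: "f x \<le> p x" if "x \<in> V" for x using fle[OF that] p'(2)[OF that] by simp
  moreover have "f x0 = p x0"
  proof (rule antisym)
    show "f x0 \<le> p x0" by (rule le) fact
    have "f (- x0) \<le> p' (- x0)" using fle V x0 by blast
    also have "\<dots> \<le> p (- x0 + x0) - p x0" using p'(3) V x0 by blast
    also have "\<dots> = - p x0" using sublinear_on_zero[OF vs p] by simp
    finally show "p x0 \<le> f x0" using neg x0 by simp
  qed
  ultimately show thesis using that by blast
qed

text \<open>
  The adjoint of multiplication by \<open>a\<close> is multiplication by this element, so it is the complex
  conjugate of \<open>a\<close> when \<open>'k\<close> is the complex field. It gives the passage from real-linear to
  \<open>'k\<close>-linear functionals.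
\<close>

definition conj_of :: "'k::{real_normed_field, euclidean_space} \<Rightarrow> 'k"
  where "conj_of a = of_real ((norm a)\<^sup>2) / a"

text \<open>
  Multiplication by \<open>a\<close> scales the norm by \<open>norm a\<close>; by polarization it scales the inner product.
\<close>

lemma inner_mult_both:
  fixes a x y :: "'k::{real_normed_field, euclidean_space}"
  shows "(a * x) \<bullet> (a * y) = (norm a)\<^sup>2 * (x \<bullet> y)"
proof -
  have "(a * x) \<bullet> (a * y) = ((norm (a * (x + y)))\<^sup>2 - (norm (a * x))\<^sup>2 - (norm (a * y))\<^sup>2) / 2"
    by (simp only: dot_norm distrib_left)
  also have "\<dots> = (norm a)\<^sup>2 * (((norm (x + y))\<^sup>2 - (norm x)\<^sup>2 - (norm y)\<^sup>2) / 2)"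
    by (simp add: norm_mult power_mult_distrib right_diff_distrib)
  finally show ?thesis by (simp only: dot_norm[symmetric])
qed

lemma inner_mult_left:
  fixes a x y :: "'k::{real_normed_field, euclidean_space}"
  shows "(x * a) \<bullet> y = x \<bullet> (conj_of a * y)"
proof (cases "a = 0")
  case False
  have "(x * a) \<bullet> y = (a * x) \<bullet> (a * (y / a))" using False by (simp add: mult.commute)
  also have "\<dots> = x \<bullet> ((norm a)\<^sup>2 *\<^sub>R (y / a))" by (simp only: inner_mult_both inner_scaleR_right)
  finally show ?thesis by (simp add: conj_of_def scaleR_conv_of_real)
qed (simp add: conj_of_def)

text \<open>
  Additivity is not visible in the formula for \<^const>\<open>conj_of\<close>; it holds because adjoints are additive.
\<close>

lemma conj_of_add: "conj_of (a + b) = conj_of a + conj_of b"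
proof -
  have "x \<bullet> conj_of (a + b) = x \<bullet> (conj_of a + conj_of b)" for x
    using inner_mult_left[of x "a + b" 1] inner_mult_left[of x a 1] inner_mult_left[of x b 1]
    by (simp add: distrib_left inner_add_left inner_add_right)
  then show ?thesis using vector_eq_ldot by blast
qed

lemma conj_of_mult: "conj_of (a * b) = conj_of a * conj_of b"
  by (simp add: conj_of_def norm_mult power_mult_distrib)

lemma norm_conj_of: "norm (conj_of a) = norm a"
  by (simp add: conj_of_def norm_divide norm_power power2_eq_square norm_mult)

lemma conj_of_conj_of: "conj_of (conj_of a) = a"
proof (cases "a = 0")
  case False
  then show ?thesis using norm_conj_of[of a] by (simp add: conj_of_def)
qed (simp add: conj_of_def)

definition seminorm_on ::
  "('k::real_normed_field \<Rightarrow> 'a::ab_group_add \<Rightarrow> 'a) \<Rightarrow> 'a set \<Rightarrow> ('a \<Rightarrow> real) \<Rightarrow> bool"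
  where "seminorm_on s V p \<longleftrightarrow>
    (\<forall>x\<in>V. \<forall>y\<in>V. p (x + y) \<le> p x + p y) \<and> (\<forall>c. \<forall>x\<in>V. p (s c x) = norm c * p x)"

lemma vector_space_of_real:
  fixes s :: "'k::real_normed_field \<Rightarrow> 'a::ab_group_add \<Rightarrow> 'a"
  assumes "vector_space s"
  shows "vector_space (\<lambda>t. s (of_real t))"
proof -
  interpret vector_space s by fact
  show ?thesis by unfold_locales (simp_all add: scale_right_distrib scale_left_distrib)
qed

lemma subspace_of_real:
  fixes s :: "'k::real_normed_field \<Rightarrow> 'a::ab_group_add \<Rightarrow> 'a"
  assumes "vector_space s" "module.subspace s V"
  shows "module.subspace (\<lambda>t. s (of_real t)) V"
proof -
  interpret vector_space s by fact
  interpret r: vector_space "\<lambda>t. s (of_real t)" by (rule vector_space_of_real) fact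
  show ?thesis using assms(2) by (simp add: r.subspace_def subspace_def)
qed

text \<open>
  A real-linear \<open>u\<close> with \<open>u \<le> p\<close> becomes \<open>'k\<close>-linear through the Riesz representation on \<open>'k\<close>:
  \<open>c \<mapsto> u (s c x)\<close> is the inner product with some \<open>w x\<close>, which depends conjugate-linearly on \<open>x\<close>.
  Evaluating at \<open>c = w x\<close> bounds the norm of \<open>w x\<close> by \<open>p x\<close>.
\<close>

theorem Hahn_Banach_seminorm:
  fixes s :: "'k::{real_normed_field, euclidean_space} \<Rightarrow> 'a::ab_group_add \<Rightarrow> 'a"
  assumes vs: "vector_space s" "module.subspace s V" and p: "seminorm_on s V p" and x0: "x0 \<in> V"
  obtains f where "linear_map_on s (*) V f" "\<And>x. x \<in> V \<Longrightarrow> norm (f x) \<le> p x" "norm (f x0) = p x0"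
proof -
  interpret vector_space s by fact
  have V: "\<And>u v. u \<in> V \<Longrightarrow> v \<in> V \<Longrightarrow> u + v \<in> V" "\<And>t u. u \<in> V \<Longrightarrow> s t u \<in> V"
    using vs(2) subspace_add subspace_scale by auto
  let ?r = "\<lambda>t. s (of_real t)"
  have "sublinear_on ?r V p" using p by (simp add: sublinear_on_def seminorm_on_def)
  then obtain u where u: "linear_map_on ?r (*) V u" "\<And>x. x \<in> V \<Longrightarrow> u x \<le> p x" "u x0 = p x0"
    using Hahn_Banach_sublinear[OF vector_space_of_real[OF vs(1)] subspace_of_real[OF vs] _ x0] by blast
  have uadd: "\<And>x y. x \<in> V \<Longrightarrow> y \<in> V \<Longrightarrow> u (x + y) = u x + u y"
    and uscale: "\<And>t x. x \<in> V \<Longrightarrow> u (s (of_real t) x) = t * u x"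
    using u(1) by (auto simp: linear_map_on_def)
  define w where "w x = adjoint (\<lambda>c. u (s c x)) 1" for x
  have lin: "linear (\<lambda>c. u (s c x))" if "x \<in> V" for x
  proof (rule linearI)
    show "u (s (c + d) x) = u (s c x) + u (s d x)" for c d
      using uadd V that by (simp add: scale_left_distrib)
    show "u (s (t *\<^sub>R c) x) = t *\<^sub>R u (s c x)" for t c
      using uscale[of "s c x" t] V that by (simp add: scaleR_conv_of_real)
  qed
  have w: "c \<bullet> w x = u (s c x)" if "x \<in> V" for c x
    using adjoint_works[OF lin[OF that], of c 1] by (simp add: w_def)
  define f where "f x = conj_of (w x)" for x
  have "f (x + y) = f x + f y" if "x \<in> V" "y \<in> V" for x y
  proof -
    have "c \<bullet> w (x + y) = c \<bullet> (w x + w y)" for c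
      using that V uadd by (simp add: w inner_add_right scale_right_distrib)
    then have "w (x + y) = w x + w y" using vector_eq_ldot by blast
    then show ?thesis by (simp add: f_def conj_of_add)
  qed
  moreover have "f (s a x) = a * f x" if "x \<in> V" for a x
  proof -
    have "c \<bullet> w (s a x) = c \<bullet> (conj_of a * w x)" for c
      using that V inner_mult_left[of c a "w x", symmetric] by (simp add: w)
    then have "w (s a x) = conj_of a * w x" using vector_eq_ldot by blast
    then show ?thesis by (simp add: f_def conj_of_mult conj_of_conj_of)
  qed
  moreover have le: "norm (f x) \<le> p x" if x: "x \<in> V" for x
  proof -
    have "norm (w x) * norm (w x) = u (s (w x) x)"
      using w[OF x, of "w x"] by (simp add: dot_square_norm power2_eq_square)
    also have "\<dots> \<le> norm (w x) * p x"
      using u(2)[of "s (w x) x"] V x p by (simp add: seminorm_on_def)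
    finally have "w x \<noteq> 0 \<Longrightarrow> norm (w x) \<le> p x" by simp
    moreover have "0 \<le> p x" if "w x = 0"
      using u(2)[OF x] w[OF x, of 1] that by simp
    ultimately show ?thesis by (cases "w x = 0") (auto simp: f_def norm_conj_of)
  qed
  moreover have "norm (f x0) = p x0"
  proof (rule antisym)
    have "p x0 = 1 \<bullet> w x0" using w[OF x0, of 1] u(3) by simp
    also have "\<dots> \<le> norm (1 :: 'k) * norm (w x0)" by (rule norm_cauchy_schwarz)
    finally show "p x0 \<le> norm (f x0)" by (simp add: f_def norm_conj_of)
  qed (rule le[OF x0])
  ultimately show thesis using that[of f] by (simp add: linear_map_on_def)
qed

section \<open>Gauges and separation\<close>

lemma absolutely_convexD:
  "absolutely_convex s A \<Longrightarrow> x \<in> A \<Longrightarrow> y \<in> A \<Longrightarrow> norm a + norm b \<le> 1 \<Longrightarrow> s a x + s b y \<in> A"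
  by (simp add: absolutely_convex_def)

lemma absolutely_convex_scale:
  assumes "vector_space s" "absolutely_convex s W" "x \<in> W" "norm c \<le> 1"
  shows "s c x \<in> W"
proof -
  interpret vector_space s by fact
  have "s c x + s 0 x \<in> W"
    using assms(2-4) unfolding absolutely_convex_def by (metis add.right_neutral norm_zero)
  then show ?thesis by simp
qed

lemma absolutely_convex_subspace:
  assumes "vector_space s" "module.subspace s M"
  shows "absolutely_convex s M"
proof -
  interpret vector_space s by fact
  show ?thesis using assms(2) by (simp add: absolutely_convex_def subspace_add subspace_scale)
qed

lemma absolutely_convex_sum:
  assumes "vector_space s" "absolutely_convex s A" "absolutely_convex s B"
  shows "absolutely_convex s {a + b | a b. a \<in> A \<and> b \<in> B}"
  unfolding absolutely_convex_def
proof (intro ballI allI impI)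
  interpret vector_space s by fact
  fix x y :: 'b and c d :: 'a
  assume "x \<in> {a + b | a b. a \<in> A \<and> b \<in> B}" "y \<in> {a + b | a b. a \<in> A \<and> b \<in> B}"
    and cd: "norm c + norm d \<le> 1"
  then obtain a b a' b' where x: "x = a + b" "a \<in> A" "b \<in> B" and y: "y = a' + b'" "a' \<in> A" "b' \<in> B"
    by blast
  have "s c x + s d y = (s c a + s d a') + (s c b + s d b')"
    by (simp add: x y scale_right_distrib algebra_simps)
  then show "s c x + s d y \<in> {a + b | a b. a \<in> A \<and> b \<in> B}"
    using assms(2,3) x y cd unfolding absolutely_convex_def by blast
qed

lemma absorbs_absolutely_convex:
  assumes vs: "vector_space s" and W: "absolutely_convex s W" and t: "t > 0"
    and B: "\<And>x. x \<in> B \<Longrightarrow> s (of_real (1 / t)) x \<in> W"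
  shows "absorbs s W B"
  unfolding absorbs_def
proof (intro exI conjI allI impI subsetI)
  interpret vector_space s by fact
  fix c :: 'a and x assume c: "t \<le> norm c" and x: "x \<in> B"
  then have c0: "c \<noteq> 0" using t by auto
  have "norm (of_real t / c) \<le> 1" using c c0 t by (simp add: norm_divide divide_simps)
  then have "s (of_real t / c) (s (of_real (1 / t)) x) \<in> W"
    by (rule absolutely_convex_scale[OF vs W B[OF x]])
  moreover have "s c (s (of_real t / c) (s (of_real (1 / t)) x)) = x"
    using c0 t by simp
  ultimately show "x \<in> s c ` W" by (metis imageI)
qed (rule t)

lemma absorbs_mono: "absorbs s U B \<Longrightarrow> U \<subseteq> U' \<Longrightarrow> absorbs s U' B"
  unfolding absorbs_def by (meson image_mono order_trans)

definition gauge_of :: "('k::real_normed_field \<Rightarrow> 'a \<Rightarrow> 'a) \<Rightarrow> 'a set \<Rightarrow> 'a \<Rightarrow> real"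
  where "gauge_of s W x = Inf {t. t > 0 \<and> s (of_real (1 / t)) x \<in> W}"

lemma gauge_of_le: "t > 0 \<Longrightarrow> s (of_real (1 / t)) x \<in> W \<Longrightarrow> gauge_of s W x \<le> t"
  unfolding gauge_of_def by (intro cInf_lower bdd_belowI[of _ 0]) auto

lemma gauge_of_less:
  assumes vs: "vector_space s" and W: "absolutely_convex s W"
    and ab: "\<exists>t>0. s (of_real (1 / t)) x \<in> W" and t: "gauge_of s W x < t"
  shows "t > 0" "s (of_real (1 / t)) x \<in> W"
proof -
  interpret vector_space s by fact
  obtain u where u: "u > 0" "s (of_real (1 / u)) x \<in> W" "u < t"
    using cInf_lessD[of "{t. t > 0 \<and> s (of_real (1 / t)) x \<in> W}" t] ab t
    unfolding gauge_of_def by blast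
  then show t0: "t > 0" by simp
  have "s (of_real (u / t)) (s (of_real (1 / u)) x) \<in> W"
    by (rule absolutely_convex_scale[OF vs W u(2)]) (use u t0 in \<open>simp add: norm_divide\<close>)
  then show "s (of_real (1 / t)) x \<in> W" using u by simp
qed

text \<open>
  All inequalities for the infimum reduce, by letting \<open>t\<close> decrease to the gauge, to membership of
  rescaled points in \<open>W\<close>, which is what absolute convexity gives.
\<close>

lemma seminorm_on_gauge_of:
  assumes vs: "vector_space s" "module.subspace s V" and W: "absolutely_convex s W"
    and ab: "\<And>x. x \<in> V \<Longrightarrow> \<exists>t>0. s (of_real (1 / t)) x \<in> W"
  shows "seminorm_on s V (gauge_of s W)"
proof -
  interpret vector_space s by fact
  let ?p = "gauge_of s W"
  note less = gauge_of_less[OF vs(1) W ab]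
  have V: "\<And>u v. u \<in> V \<Longrightarrow> v \<in> V \<Longrightarrow> u + v \<in> V" "\<And>t u. u \<in> V \<Longrightarrow> s t u \<in> V"
    using vs(2) subspace_add subspace_scale by auto
  have "?p (x + y) \<le> ?p x + ?p y" if x: "x \<in> V" and y: "y \<in> V" for x y
  proof -
    have *: "?p (x + y) \<le> t + u" if t: "?p x < t" and u: "?p y < u" for t u
    proof (rule gauge_of_le)
      note t' = less[OF x t] and u' = less[OF y u]
      show "t + u > 0" using t'(1) u'(1) by simp
      have "norm (of_real (t / (t + u)) :: 'a) + norm (of_real (u / (t + u)) :: 'a) \<le> 1"
        using t'(1) u'(1) by (simp only: norm_of_real) (simp add: add_divide_distrib[symmetric])
      then have "s (of_real (t / (t + u))) (s (of_real (1 / t)) x)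
          + s (of_real (u / (t + u))) (s (of_real (1 / u)) y) \<in> W"
        by (rule absolutely_convexD[OF W t'(2) u'(2)])
      then show "s (of_real (1 / (t + u))) (x + y) \<in> W"
        using t'(1) u'(1) by (simp add: scale_right_distrib)
    qed
    have "?p (x + y) - u \<le> ?p x" if "?p y < u" for u
      by (rule dense_ge) (use *[OF _ that] in \<open>simp add: diff_le_eq\<close>)
    then have "?p (x + y) - ?p x \<le> ?p y"
      by - (rule dense_ge, simp add: algebra_simps)
    then show ?thesis by simp
  qed
  moreover have scale_le: "?p (s c x) \<le> norm c * ?p x" if x: "x \<in> V" and c: "c \<noteq> 0" for c x
  proof -
    have "?p (s c x) / norm c \<le> t" if t: "?p x < t" for t
    proof -
      note t' = less[OF x t]
      have "s (c / of_real (norm c)) (s (of_real (1 / t)) x) \<in> W"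
        using c by (intro absolutely_convex_scale[OF vs(1) W t'(2)]) (simp add: norm_divide)
      then have "?p (s c x) \<le> norm c * t"
        using c t'(1) by (intro gauge_of_le) (simp_all add: mult.commute)
      then show ?thesis using c by (simp add: field_simps)
    qed
    then have "?p (s c x) / norm c \<le> ?p x" by (rule dense_ge)
    then show ?thesis using c by (simp add: field_simps)
  qed
  moreover have "?p (s c x) = norm c * ?p x" if x: "x \<in> V" for c x
  proof (cases "c = 0")
    case True
    obtain t where t: "t > 0" "s (of_real (1 / t)) x \<in> W" using ab x by blast
    have z: "0 \<in> W" using absolutely_convex_scale[OF vs(1) W t(2), of 0] by simp
    have "?p 0 \<le> u" if "u > 0" for u using gauge_of_le[of u s 0 W] z that by simp
    then have "?p 0 \<le> 0" by (rule dense_ge)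
    moreover have "0 \<le> ?p 0"
      unfolding gauge_of_def by (rule cInf_greatest) (use z gt_ex[of "0::real"] in auto)
    ultimately show ?thesis using True by simp
  next
    case False
    have "?p (s (1 / c) (s c x)) \<le> norm (1 / c) * ?p (s c x)"
      by (rule scale_le) (use V x False in simp_all)
    then have "norm c * ?p x \<le> ?p (s c x)" using False by (simp add: norm_divide field_simps)
    with scale_le[OF x False] show ?thesis by simp
  qed
  ultimately show ?thesis by (simp add: seminorm_on_def)
qed

lemma separation_absolutely_convex:
  fixes s :: "'k::{real_normed_field, euclidean_space} \<Rightarrow> 'a::ab_group_add \<Rightarrow> 'a"
  assumes vs: "vector_space s" "module.subspace s V" and W: "absolutely_convex s W"
    and ab: "\<And>x. x \<in> V \<Longrightarrow> \<exists>t>0. s (of_real (1 / t)) x \<in> W"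
    and x: "x \<in> V" "x \<notin> W"
  obtains f where "linear_map_on s (*) V f" "\<And>y. y \<in> V \<Longrightarrow> y \<in> W \<Longrightarrow> norm (f y) \<le> 1" "norm (f x) \<ge> 1"
proof -
  interpret vector_space s by fact
  obtain f where f: "linear_map_on s (*) V f" "\<And>y. y \<in> V \<Longrightarrow> norm (f y) \<le> gauge_of s W y"
    "norm (f x) = gauge_of s W x"
    using Hahn_Banach_seminorm[OF vs seminorm_on_gauge_of[OF vs W ab] x(1)] by blast
  have "gauge_of s W y \<le> 1" if "y \<in> W" for y using gauge_of_le[of 1 s y W] that by simp
  moreover have "gauge_of s W x \<ge> 1"
    using gauge_of_less(2)[OF vs(1) W ab[OF x(1)], of 1] x(2) by force
  ultimately show thesis using that[OF f(1)] f(2,3) by force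
qed

lemma linear_map_on_zero:
  assumes "vector_space s" "module.subspace s V" "linear_map_on s (*) V f"
  shows "f 0 = 0"
proof -
  interpret vector_space s by fact
  have "f (s 0 0) = 0 * f 0"
    using assms(2,3) subspace_0 unfolding linear_map_on_def by blast
  then show ?thesis by simp
qed

lemma linear_map_on_diff:
  assumes "vector_space s" "module.subspace s V" "linear_map_on s (*) V f" "x \<in> V" "y \<in> V"
  shows "f (x - y) = f x - f y"
proof -
  interpret vector_space s by fact
  have "f (x + s (- 1) y) = f x + f (s (- 1) y)" "f (s (- 1) y) = - 1 * f y"
    using assms(2-5) subspace_scale[OF assms(2)] unfolding linear_map_on_def by blast+
  then show ?thesis by simp
qed

text \<open>
  Scaling \<open>x\<close> inside \<open>M\<close> would make a nonzero value exceed any bound.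
\<close>

lemma linear_map_on_bounded_subspace:
  assumes "vector_space s" "module.subspace s M" "linear_map_on s (*) V f" "M \<subseteq> V"
    and b: "\<And>x. x \<in> M \<Longrightarrow> norm (f x) \<le> K" and x: "x \<in> M"
  shows "f x = (0 :: 'k::real_normed_field)"
proof (rule ccontr)
  interpret vector_space s by fact
  assume nz: "f x \<noteq> 0"
  let ?c = "of_real ((\<bar>K\<bar> + 1) / norm (f x)) :: 'k"
  have "s ?c x \<in> M" using subspace_scale[OF assms(2) x] .
  then have "norm (f (s ?c x)) \<le> K" by (rule b)
  moreover have "f (s ?c x) = ?c * f x"
    using assms(3,4) x unfolding linear_map_on_def by blast
  then have "norm (f (s ?c x)) = \<bar>(\<bar>K\<bar> + 1) / norm (f x)\<bar> * norm (f x)"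
    by (simp only: norm_mult norm_of_real)
  then have "norm (f (s ?c x)) = \<bar>K\<bar> + 1" using nz by simp
  ultimately show False by simp
qed

section \<open>Neighbourhoods and functionals in a locally convex space\<close>

context
  fixes s :: "'k::{real_normed_field, euclidean_space} \<Rightarrow> 'a::ab_group_add \<Rightarrow> 'a" and X :: "'a topology"
  assumes lcs: "locally_convex_space s X"
begin

lemma lcs_vector_space: "vector_space s" and lcs_subspace: "module.subspace s (topspace X)"
  using lcs by (auto simp: locally_convex_space_def)

lemma lcs_topspace:
  "0 \<in> topspace X" "x \<in> topspace X \<Longrightarrow> y \<in> topspace X \<Longrightarrow> x + y \<in> topspace X"
  "x \<in> topspace X \<Longrightarrow> s c x \<in> topspace X"
proof -
  interpret vector_space s by (rule lcs_vector_space)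
  show "0 \<in> topspace X" "x \<in> topspace X \<Longrightarrow> y \<in> topspace X \<Longrightarrow> x + y \<in> topspace X"
    "x \<in> topspace X \<Longrightarrow> s c x \<in> topspace X"
    using lcs_subspace subspace_0 subspace_add subspace_scale by auto
qed

lemma lcs_continuous_scale:
  "continuous_map X X (s c)"
  "x \<in> topspace X \<Longrightarrow> continuous_map euclidean X (\<lambda>c. s c x)"
proof -
  have c: "continuous_map (prod_topology euclidean X) X (\<lambda>(c, x). s c x)"
    using lcs by (simp add: locally_convex_space_def)
  have "continuous_map X (prod_topology euclidean X) (\<lambda>x. (c, x))"
    by (intro continuous_map_pairedI) auto
  from continuous_map_compose[OF this c] show "continuous_map X X (s c)"
    by (simp add: o_def)
  assume "x \<in> topspace X"
  then have "continuous_map euclidean (prod_topology euclidean X) (\<lambda>c. (c, x))"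
    by (intro continuous_map_pairedI) auto
  from continuous_map_compose[OF this c] show "continuous_map euclidean X (\<lambda>c. s c x)"
    by (simp add: o_def)
qed

lemma lcs_continuous_translate:
  assumes "x \<in> topspace X"
  shows "continuous_map X X (\<lambda>y. y + x)"
proof -
  have c: "continuous_map (prod_topology X X) X (\<lambda>(x, y). x + y)"
    using lcs by (simp add: locally_convex_space_def)
  have "continuous_map X (prod_topology X X) (\<lambda>y. (y, x))"
    using assms by (intro continuous_map_pairedI) auto
  from continuous_map_compose[OF this c] show ?thesis by (simp add: o_def)
qed

lemma lcs_nbhd_absorbs_points:
  assumes U: "0 \<in> X interior_of U" and x: "x \<in> topspace X"
  shows "\<exists>t>0. s (of_real (1 / t)) x \<in> U"
proof -
  interpret vector_space s by (rule lcs_vector_space)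
  let ?S = "{c \<in> topspace euclidean. s c x \<in> X interior_of U}"
  have "open ?S"
    using openin_continuous_map_preimage[OF lcs_continuous_scale(2)[OF x] openin_interior_of]
    by (simp add: open_openin[symmetric])
  moreover have "0 \<in> ?S" using U by simp
  ultimately obtain e where e: "e > 0" "ball 0 e \<subseteq> ?S" using open_contains_ball by blast
  have "of_real (1 / (2 / e)) \<in> ball (0::'k) e" using e(1) by (simp add: norm_divide)
  then have "s (of_real (1 / (2 / e))) x \<in> U" using e(2) interior_of_subset by fastforce
  then show ?thesis using e(1) by (intro exI[of _ "2 / e"]) simp
qed

text \<open>
  The balanced core of a convex neighbourhood. It is convex and balanced, and joint continuity of
  the scalar multiplication at \<open>(0, 0)\<close> makes it a neighbourhood of \<open>0\<close>.
\<close>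

lemma lcs_absolutely_convex_nbhd:
  assumes U: "0 \<in> X interior_of U"
  obtains A where "absolutely_convex s A" "0 \<in> X interior_of A" "A \<subseteq> U"
proof -
  interpret vector_space s by (rule lcs_vector_space)
  have "neighbourhood_base_at 0 (convex_set s) X"
    using lcs by (simp add: locally_convex_space_def)
  then obtain G V where G: "openin X G" "0 \<in> G" "G \<subseteq> V" and V: "convex_set s V" "V \<subseteq> X interior_of U"
    using U openin_interior_of unfolding neighbourhood_base_at_def by metis
  define A where "A = {x \<in> topspace X. \<forall>c. norm c \<le> 1 \<longrightarrow> s c x \<in> V}"
  have "absolutely_convex s A"
    unfolding absolutely_convex_def
  proof (intro ballI allI impI)
    fix x y :: 'a and a b :: 'k
    assume x: "x \<in> A" and y: "y \<in> A" and ab: "norm a + norm b \<le> 1"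
    have "s c (s a x + s b y) \<in> V" if c: "norm c \<le> 1" for c
    proof -
      define t where "t = norm b"
      have t: "0 \<le> t" "t \<le> 1" "norm a \<le> 1 - t"
        using ab norm_ge_zero[of a] norm_ge_zero[of b] by (auto simp only: t_def)
      \<comment> \<open>The combination is a convex one with weights \<open>1 - t\<close> and \<open>t\<close>; division by \<open>0\<close> gives \<open>0\<close>, which fits the degenerate cases.\<close>
      define u where "u = c * a / of_real (1 - t)"
      define v where "v = c * b / of_real t"
      have "norm u = norm c * (norm a / (1 - t))"
        unfolding u_def norm_divide norm_mult norm_of_real using t by simp
      also have "\<dots> \<le> 1 * 1"
        using t c by (intro mult_mono) (auto simp: divide_le_eq)
      finally have "norm u \<le> 1" by simp
      moreover have "norm v \<le> 1"
        unfolding v_def norm_divide norm_mult norm_of_real t_def using c by (simp add: divide_le_eq)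
      ultimately have "s u x \<in> V" "s v y \<in> V" using x y by (auto simp: A_def)
      then have "s (of_real (1 - t)) (s u x) + s (of_real t) (s v y) \<in> V"
        using V(1) t unfolding convex_set_def by blast
      moreover have "of_real (1 - t) * u = c * a"
      proof (cases "t = 1")
        case True then have "a = 0" using t(3) by simp
        then show ?thesis by (simp add: u_def)
      next
        case False
        then have "1 - t \<noteq> 0" by simp
        then have "of_real (1 - t) \<noteq> (0::'k)" by (simp only: of_real_eq_0_iff not_False_eq_True)
        then show ?thesis by (simp add: u_def del: of_real_diff)
      qed
      moreover have "of_real t * v = c * b" by (simp add: v_def t_def)
      ultimately show ?thesis by (simp add: scale_right_distrib del: of_real_diff)
    qed
    moreover have "s a x + s b y \<in> topspace X" using x y lcs_topspace by (auto simp: A_def)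
    ultimately show "s a x + s b y \<in> A" by (simp add: A_def)
  qed
  moreover have "A \<subseteq> U"
  proof
    fix x assume "x \<in> A"
    then have "norm (1::'k) \<le> 1 \<longrightarrow> s 1 x \<in> V" unfolding A_def by blast
    then show "x \<in> U" using V(2) interior_of_subset by fastforce
  qed
  moreover have "0 \<in> X interior_of A"
  proof -
    have c: "continuous_map (prod_topology euclidean X) X (\<lambda>(c, x). s c x)"
      using lcs by (simp add: locally_convex_space_def)
    define R where "R = {z \<in> topspace (prod_topology euclidean X). (case z of (c, x) \<Rightarrow> s c x) \<in> G}"
    have R: "openin (prod_topology euclidean X) R"
      unfolding R_def by (rule openin_continuous_map_preimage[OF c G(1)])
    have "(0, 0) \<in> R" using lcs_topspace(1) G(2) by (simp add: R_def)
    from openin_prod_topology_alt[THEN iffD1, OF R, rule_format, OF this]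
    obtain P Q where P: "openin euclidean P" "(0::'k) \<in> P" and Q: "openin X Q" "0 \<in> Q"
      and PQ: "P \<times> Q \<subseteq> R"
      by (elim exE conjE)
    have "open P" using P(1) by (simp add: open_openin[symmetric])
    then obtain e where e: "e > 0" "ball 0 e \<subseteq> P" using P(2) open_contains_ball by blast
    define d :: 'k where "d = of_real (e / 2)"
    have d: "d \<noteq> 0" "norm d < e" using e(1) by (simp_all add: d_def)
    define N where "N = {x \<in> topspace X. s (1 / d) x \<in> Q}"
    have "openin X N"
      unfolding N_def by (rule openin_continuous_map_preimage[OF lcs_continuous_scale(1) Q(1)])
    moreover have "0 \<in> N" using lcs_topspace(1) Q(2) by (simp add: N_def)
    moreover have "N \<subseteq> A"
    proof
      fix x assume x: "x \<in> N"
      have "s c x \<in> V" if c: "norm c \<le> 1" for c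
      proof -
        have "norm (c * d) \<le> 1 * norm d" unfolding norm_mult using c by (intro mult_right_mono) auto
        then have "c * d \<in> P" using e(2) d(2) by auto
        then have "s (c * d) (s (1 / d) x) \<in> G" using PQ x by (auto simp: N_def R_def)
        then show ?thesis using d(1) G(3) by auto
      qed
      then show "x \<in> A" using x by (simp add: A_def N_def)
    qed
    ultimately show ?thesis unfolding interior_of_def by blast
  qed
  ultimately show thesis using that by blast
qed

lemma lcs_continuous_functional:
  assumes f: "linear_map_on s (*) (topspace X) f" and U: "0 \<in> X interior_of U"
    and K: "\<And>x. x \<in> topspace X \<Longrightarrow> x \<in> U \<Longrightarrow> norm (f x) \<le> K"
  shows "continuous_map X euclidean f"
  unfolding continuous_map_def
proof (intro conjI allI impI)
  interpret vector_space s by (rule lcs_vector_space)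
  note neg = subspace_neg[OF lcs_subspace]
  fix S :: "'k set" assume "openin euclidean S"
  then have S: "open S" by (simp add: open_openin[symmetric])
  show "openin X {x \<in> topspace X. f x \<in> S}"
  proof (subst openin_subopen, intro ballI)
    fix x assume "x \<in> {x \<in> topspace X. f x \<in> S}"
    then have x: "x \<in> topspace X" "f x \<in> S" by auto
    obtain e where e: "e > 0" "ball (f x) e \<subseteq> S" using S x(2) open_contains_ball by blast
    have K0: "K \<ge> 0"
      using K[of 0] U interior_of_subset[of X U] lcs_topspace(1) norm_ge_zero order_trans by blast
    define d :: 'k where "d = of_real (e / (K + 1))"
    have nd: "norm d = e / (K + 1)"
      unfolding d_def norm_of_real using e(1) K0 by simp
    then have d: "d \<noteq> 0" "norm d * K < e"
      using e(1) K0 by (auto simp: divide_less_eq algebra_simps)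
    define T where "T = {y \<in> topspace X. s (1 / d) (y + - x) \<in> X interior_of U}"
    have c: "continuous_map X X (\<lambda>y. s (1 / d) (y + - x))"
      using continuous_map_compose[OF lcs_continuous_translate lcs_continuous_scale(1), of "- x" "1 / d"] neg x(1)
      by (simp add: o_def)
    have "openin X T"
      unfolding T_def by (rule openin_continuous_map_preimage[OF c openin_interior_of])
    moreover have "x \<in> T" using x(1) U by (simp add: T_def)
    moreover have "T \<subseteq> {x \<in> topspace X. f x \<in> S}"
    proof
      fix y assume y: "y \<in> T"
      then have yX: "y \<in> topspace X" and "s (1 / d) (y + - x) \<in> U"
        using interior_of_subset by (fastforce simp: T_def)+
      moreover have "y + - x \<in> topspace X" using lcs_topspace(2) neg x yX by blast
      ultimately have "norm (f (s (1 / d) (y + - x))) \<le> K" using K lcs_topspace(3) by blast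
      moreover have "f (s (1 / d) (y + - x)) = (1 / d) * (f y - f x)"
        using f lcs_topspace neg x yX linear_map_on_diff[OF lcs_vector_space lcs_subspace f yX x(1)]
        \<open>y + - x \<in> topspace X\<close> unfolding linear_map_on_def by auto
      ultimately have "norm ((1 / d) * (f y - f x)) \<le> K" by (simp only:)
      then have "norm (f y - f x) \<le> norm d * K"
        unfolding norm_mult norm_divide using d(1) by (simp add: divide_le_eq mult.commute)
      then have "f y \<in> ball (f x) e" using d(2) by (simp add: dist_norm norm_minus_commute)
      then show "y \<in> {x \<in> topspace X. f x \<in> S}" using e(2) yX by auto
    qed
    ultimately show "\<exists>T. openin X T \<and> x \<in> T \<and> T \<subseteq> {x \<in> topspace X. f x \<in> S}" by blast
  qed
qed auto

text \<open>
  Elements of the dual vanish outside \<open>topspace X\<close>, so a functional has to be cut off there.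
\<close>

lemma lcs_extend_to_dual:
  assumes f: "linear_map_on s (*) (topspace X) f" and U: "0 \<in> X interior_of U"
    and K: "\<And>x. x \<in> topspace X \<Longrightarrow> x \<in> U \<Longrightarrow> norm (f x) \<le> K"
  obtains g where "g \<in> continuous_dual s X" "\<And>x. x \<in> topspace X \<Longrightarrow> g x = f x"
proof
  let ?g = "\<lambda>x. if x \<in> topspace X then f x else 0"
  have "continuous_map X euclidean ?g"
    using lcs_continuous_functional[OF f U K] by (rule continuous_map_eq) auto
  moreover have "linear_map_on s (*) (topspace X) ?g"
    using f lcs_topspace by (simp add: linear_map_on_def)
  ultimately show "?g \<in> continuous_dual s X" by (simp add: continuous_dual_def)
qed auto

text \<open>
  Some absolutely convex neighbourhood \<open>A\<close> of \<open>0\<close> keeps \<open>x\<close> out of \<open>M + A\<close>. A functional that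
  separates \<open>x\<close> from \<open>M + A\<close> is continuous, being bounded on \<open>A\<close>, and vanishes on the subspace \<open>M\<close>.
\<close>

lemma lcs_separation_subspace:
  assumes M: "module.subspace s M" "M \<subseteq> topspace X" and x: "x \<in> topspace X" "x \<notin> X closure_of M"
  obtains f where "f \<in> continuous_dual s X" "\<And>y. y \<in> M \<Longrightarrow> f y = 0" "f x \<noteq> 0"
proof -
  interpret vector_space s by (rule lcs_vector_space)
  obtain G where G: "openin X G" "x \<in> G" "G \<inter> M = {}"
    using x by (auto simp: in_closure_of)
  let ?N = "{y \<in> topspace X. y + x \<in> G}"
  have "openin X ?N"
    by (rule openin_continuous_map_preimage[OF lcs_continuous_translate[OF x(1)] G(1)])
  moreover have "0 \<in> ?N" using lcs_topspace(1) G(2) by simp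
  ultimately have "0 \<in> X interior_of ?N" by (simp add: interior_of_openin)
  then obtain A where A: "absolutely_convex s A" "0 \<in> X interior_of A" "A \<subseteq> ?N"
    by (rule lcs_absolutely_convex_nbhd)
  have A0: "0 \<in> A" using A(2) interior_of_subset by fastforce
  let ?W = "{m + a | m a. m \<in> M \<and> a \<in> A}"
  have W: "absolutely_convex s ?W"
    by (rule absolutely_convex_sum[OF lcs_vector_space absolutely_convex_subspace[OF lcs_vector_space M(1)] A(1)])
  have AW: "A \<subseteq> ?W" using subspace_0[OF M(1)] by force
  have MW: "M \<subseteq> ?W" using A0 by force
  have ab: "\<exists>t>0. s (of_real (1 / t)) y \<in> ?W" if "y \<in> topspace X" for y
    using lcs_nbhd_absorbs_points[OF A(2) that] AW by blast
  have "x \<notin> ?W"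
  proof
    assume "x \<in> ?W"
    then obtain m a where ma: "x = m + a" "m \<in> M" "a \<in> A" by blast
    have "s (- 1) a \<in> A" by (rule absolutely_convex_scale[OF lcs_vector_space A(1) ma(3)]) simp
    then have "- a + x \<in> G" using A(3) by auto
    then show False using ma G(3) by auto
  qed
  then obtain f where f: "linear_map_on s (*) (topspace X) f"
    "\<And>y. y \<in> topspace X \<Longrightarrow> y \<in> ?W \<Longrightarrow> norm (f y) \<le> 1" "norm (f x) \<ge> 1"
    using separation_absolutely_convex[OF lcs_vector_space lcs_subspace W ab x(1)] by blast
  obtain g where g: "g \<in> continuous_dual s X" "\<And>x. x \<in> topspace X \<Longrightarrow> g x = f x"
    using lcs_extend_to_dual[OF f(1) A(2), of 1] f(2) AW by blast
  have "f y = 0" if "y \<in> M" for y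
    by (rule linear_map_on_bounded_subspace[OF lcs_vector_space M(1) f(1) M(2) _ that])
      (use f(2) M(2) MW in blast)
  then show thesis using that[OF g(1)] g(2) M(2) x(1) f(3) by force
qed

lemma bounded_functional_on_bounded:
  assumes f: "f \<in> continuous_dual s X" and B: "bounded_in s X B"
  obtains K where "K > 0" "\<And>x. x \<in> B \<Longrightarrow> norm (f x) \<le> K"
proof -
  interpret vector_space s by (rule lcs_vector_space)
  have lin: "linear_map_on s (*) (topspace X) f" and cont: "continuous_map X euclidean f"
    using f by (auto simp: continuous_dual_def)
  let ?U = "{x \<in> topspace X. f x \<in> ball 0 1}"
  have "openin X ?U"
    by (rule openin_continuous_map_preimage[OF cont]) simp
  moreover have "0 \<in> ?U"
    using lcs_topspace(1) linear_map_on_zero[OF lcs_vector_space lcs_subspace lin] by simp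
  ultimately have "0 \<in> X interior_of ?U" by (simp add: interior_of_openin)
  then obtain r where r: "r > 0" "\<And>c. r \<le> norm c \<Longrightarrow> B \<subseteq> s c ` ?U"
    using B unfolding bounded_in_def absorbs_def by blast
  have "norm (f x) \<le> r" if "x \<in> B" for x
  proof -
    obtain u where u: "u \<in> ?U" "x = s (of_real r) u" using r(2)[of "of_real r"] r(1) \<open>x \<in> B\<close> by auto
    then have "f x = of_real r * f u" using lin by (auto simp: linear_map_on_def)
    then show ?thesis using u(1) r(1) by (simp add: norm_mult mult_left_le)
  qed
  then show thesis using that r(1) by blast
qed

end

section \<open>Mackey's theorem: weakly bounded sets are bounded\<close>

text \<open>
  The constant \<open>3 / 2\<close> is the sum of the geometric series with ratio \<open>1 / 3\<close>.
\<close>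

lemma geometric_steps_converge:
  fixes a :: "nat \<Rightarrow> 'k::banach"
  assumes step: "\<And>n. norm (a (Suc n) - a n) \<le> (1 / 3) ^ n * C"
  obtains l where "a \<longlonglongrightarrow> l" "\<And>n. norm (l - a n) \<le> 3 / 2 * (1 / 3) ^ n * C"
proof -
  have summable: "summable (\<lambda>n. (1 / 3 :: real) ^ n * C)"
    by (intro summable_mult2 summable_geometric) simp
  have "summable (\<lambda>n. a (Suc n) - a n)"
    by (rule summable_comparison_test'[OF summable step])
  then have "convergent (\<lambda>n. \<Sum>k<n. a (Suc k) - a k)"
    by (simp add: summable_iff_convergent)
  then have "convergent (\<lambda>n. a n - a 0)" by (simp add: sum_lessThan_telescope)
  then have "convergent (\<lambda>n. (a n - a 0) + a 0)" by (intro convergent_add convergent_const)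
  then obtain l where l: "a \<longlonglongrightarrow> l" by (auto simp: convergent_def)
  have C: "C \<ge> 0" using order_trans[OF norm_ge_zero step[of 0]] by simp
  have tail: "norm (a (n + m) - a n) \<le> 3 / 2 * ((1 / 3) ^ n - (1 / 3) ^ (n + m)) * C" for n m
  proof (induction m)
    case (Suc m)
    have "norm (a (n + Suc m) - a n) \<le> norm (a (Suc (n + m)) - a (n + m)) + norm (a (n + m) - a n)"
      using norm_triangle_ineq[of "a (Suc (n + m)) - a (n + m)" "a (n + m) - a n"] by simp
    also have "\<dots> \<le> (1 / 3) ^ (n + m) * C + 3 / 2 * ((1 / 3) ^ n - (1 / 3) ^ (n + m)) * C"
      using step Suc.IH by (rule add_mono)
    also have "\<dots> = 3 / 2 * ((1 / 3) ^ n - (1 / 3) ^ (n + Suc m)) * C"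
      by (simp add: field_simps)
    finally show ?case .
  qed simp
  have "norm (l - a n) \<le> 3 / 2 * (1 / 3) ^ n * C" for n
  proof (rule tendsto_upperbound)
    show "(\<lambda>m. norm (a (n + m) - a n)) \<longlonglongrightarrow> norm (l - a n)"
      using LIMSEQ_ignore_initial_segment[OF l, of n]
      by (intro tendsto_intros) (simp add: add.commute)
    have "norm (a (n + m) - a n) \<le> 3 / 2 * (1 / 3) ^ n * C" for m
    proof -
      have "3 / 2 * ((1 / 3) ^ n - (1 / 3) ^ (n + m)) * C \<le> 3 / 2 * (1 / 3) ^ n * C"
        using C by (intro mult_right_mono) auto
      then show ?thesis using tail[of n m] by simp
    qed
    then show "\<forall>\<^sub>F m in sequentially. norm (a (n + m) - a n) \<le> 3 / 2 * (1 / 3) ^ n * C" by simp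
  qed simp
  then show thesis using that l by blast
qed

lemma norm_add_or_diff:
  fixes a b :: "'k::real_normed_vector"
  shows "norm b \<le> norm (a + b) \<or> norm b \<le> norm (a - b)"
proof -
  have "2 * norm b = norm ((a + b) - (a - b))" by (simp add: scaleR_2[symmetric])
  also have "\<dots> \<le> norm (a + b) + norm (a - b)" by (rule norm_triangle_ineq4)
  finally show ?thesis by linarith
qed

text \<open>
  A gliding hump argument. If \<open>p (y n) > 4 ^ n\<close> with \<open>y n\<close> in \<open>D\<close>, choose functionals \<open>h n\<close> below \<open>p\<close>
  that attain \<open>p\<close> at \<open>y n\<close>, and sum \<open>\<plusminus> (1 / 3) ^ n * h n\<close>. The sign makes the partial sum through
  index \<open>n\<close> at least \<open>(1 / 3) ^ n * p (y n)\<close> at \<open>y n\<close>, while the later terms add up to at most half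
  of that. So the limit is at least \<open>(4 / 3) ^ n / 2\<close> at \<open>y n\<close>, although it is bounded by
  \<open>(3 / 2) * p\<close> and hence bounded on \<open>D\<close> by hypothesis.
\<close>

lemma uniform_boundedness_seminorm:
  fixes s :: "'k::{real_normed_field, euclidean_space} \<Rightarrow> 'a::ab_group_add \<Rightarrow> 'a"
  assumes vs: "vector_space s" "module.subspace s V" and p: "seminorm_on s V p" and D: "D \<subseteq> V"
    and wb: "\<And>f. linear_map_on s (*) V f \<Longrightarrow> (\<And>x. x \<in> V \<Longrightarrow> norm (f x) \<le> 2 * p x) \<Longrightarrow>
      \<exists>K. \<forall>y\<in>D. norm (f y) \<le> K"
  obtains R where "\<And>y. y \<in> D \<Longrightarrow> p y \<le> R"
proof (rule ccontr)
  assume "\<not> thesis"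
  then have "\<forall>n. \<exists>y\<in>D. p y > 4 ^ n" using that by (meson linorder_not_le)
  then obtain y where yD: "\<And>n. y n \<in> D" and py: "\<And>n. p (y n) > 4 ^ n" by metis
  have yV: "y n \<in> V" for n using yD D by blast
  have "\<exists>f. linear_map_on s (*) V f \<and> (\<forall>x\<in>V. norm (f x) \<le> p x) \<and> norm (f (y n)) = p (y n)" for n
    using Hahn_Banach_seminorm[OF vs p yV[of n]] by metis
  then obtain h where h: "\<And>n. linear_map_on s (*) V (h n)" "\<And>n x. x \<in> V \<Longrightarrow> norm (h n x) \<le> p x"
    "\<And>n. norm (h n (y n)) = p (y n)"
    by metis
  define c :: "nat \<Rightarrow> 'k" where "c n = of_real ((1 / 3) ^ n)" for n
  have nc: "norm (c n) = (1 / 3) ^ n" for n unfolding c_def norm_of_real by simp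
  \<comment> \<open>\<open>g n\<close> is the partial sum of the first \<open>n\<close> terms; the sign of the next term is the one that does
    not cancel at \<open>y n\<close>.\<close>
  define g where "g = rec_nat (\<lambda>x. 0 :: 'k) (\<lambda>n u x.
    if norm (c n * h n (y n)) \<le> norm (u (y n) + c n * h n (y n)) then u x + c n * h n x
    else u x - c n * h n x)"
  have g0: "g 0 x = 0" for x by (simp add: g_def)
  have gS: "g (Suc n) x = (if norm (c n * h n (y n)) \<le> norm (g n (y n) + c n * h n (y n))
    then g n x + c n * h n x else g n x - c n * h n x)" for n x
    by (simp add: g_def)
  have glin: "linear_map_on s (*) V (g n)" for n
  proof (induction n)
    case (Suc n)
    then show ?case using h(1)[of n] by (simp add: linear_map_on_def gS algebra_simps)
  qed (simp add: linear_map_on_def g0)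
  have gy: "norm (g (Suc n) (y n)) \<ge> (1 / 3) ^ n * p (y n)" for n
    using norm_add_or_diff[of "c n * h n (y n)" "g n (y n)"]
    by (auto simp: gS norm_mult nc h(3))
  have step: "norm (g (Suc n) x - g n x) \<le> (1 / 3) ^ n * p x" if "x \<in> V" for n x
  proof -
    have "norm (g (Suc n) x - g n x) = (1 / 3) ^ n * norm (h n x)" by (simp add: gS norm_mult nc)
    also have "\<dots> \<le> (1 / 3) ^ n * p x" using h(2)[OF that] by (intro mult_left_mono) auto
    finally show ?thesis .
  qed
  have "\<exists>l. (\<lambda>n. g n x) \<longlonglongrightarrow> l \<and> (\<forall>n. norm (l - g n x) \<le> 3 / 2 * (1 / 3) ^ n * p x)"
    if "x \<in> V" for x
    using geometric_steps_converge[of "\<lambda>n. g n x", OF step[OF that]] by metis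
  then obtain f where lim: "\<And>x. x \<in> V \<Longrightarrow> (\<lambda>n. g n x) \<longlonglongrightarrow> f x"
    and tail: "\<And>x n. x \<in> V \<Longrightarrow> norm (f x - g n x) \<le> 3 / 2 * (1 / 3) ^ n * p x"
    by metis
  interpret vector_space s by fact
  have "f (u + v) = f u + f v" if "u \<in> V" "v \<in> V" for u v
  proof (rule LIMSEQ_unique)
    show "(\<lambda>n. g n (u + v)) \<longlonglongrightarrow> f (u + v)" using lim subspace_add[OF vs(2)] that by blast
    show "(\<lambda>n. g n (u + v)) \<longlonglongrightarrow> f u + f v"
      using tendsto_add[OF lim[OF that(1)] lim[OF that(2)]] glin that by (simp add: linear_map_on_def)
  qed
  moreover have "f (s b u) = b * f u" if "u \<in> V" for b u
  proof (rule LIMSEQ_unique)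
    show "(\<lambda>n. g n (s b u)) \<longlonglongrightarrow> f (s b u)" using lim subspace_scale[OF vs(2)] that by blast
    show "(\<lambda>n. g n (s b u)) \<longlonglongrightarrow> b * f u"
      using tendsto_mult_left[OF lim[OF that], of b] glin that by (simp add: linear_map_on_def)
  qed
  ultimately have "linear_map_on s (*) V f" by (simp add: linear_map_on_def)
  moreover have "norm (f x) \<le> 2 * p x" if "x \<in> V" for x
    using tail[OF that, of 0] order_trans[OF norm_ge_zero step[OF that, of 0]] by (simp add: g0)
  ultimately obtain K where K: "\<And>z. z \<in> D \<Longrightarrow> norm (f z) \<le> K" using wb by blast
  have growth: "1 / 2 * (4 / 3) ^ n \<le> K" for n
  proof -
    have "norm (g (Suc n) (y n)) \<le> norm (f (y n)) + norm (f (y n) - g (Suc n) (y n))"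
      using norm_triangle_ineq4[of "f (y n)" "f (y n) - g (Suc n) (y n)"] by simp
    then have "1 / 2 * (1 / 3) ^ n * p (y n) \<le> K"
      using gy[of n] tail[OF yV, of n "Suc n"] K[OF yD[of n]] by simp
    moreover have "1 / 2 * (1 / 3) ^ n * 4 ^ n \<le> 1 / 2 * (1 / 3) ^ n * p (y n)"
      using py[of n] by (intro mult_left_mono) auto
    moreover have "1 / 2 * (1 / 3) ^ n * 4 ^ n = 1 / 2 * (4 / 3 :: real) ^ n"
      by (simp add: power_divide)
    ultimately show ?thesis by linarith
  qed
  obtain n where "2 * K < (4 / 3 :: real) ^ n" using real_arch_pow[of "4 / 3" "2 * K"] by auto
  then show False using growth[of n] by simp
qed

text \<open>
  Functionals below a multiple of the gauge of a neighbourhood are continuous, so the uniform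
  boundedness principle applies to the gauge and \<open>D\<close>; a bound for the gauge on \<open>D\<close> says that the
  neighbourhood absorbs \<open>D\<close>.
\<close>

theorem weakly_bounded_imp_bounded_in:
  fixes s :: "'k::{real_normed_field, euclidean_space} \<Rightarrow> 'a::ab_group_add \<Rightarrow> 'a"
  assumes lcs: "locally_convex_space s X" and D: "D \<subseteq> topspace X"
    and wb: "\<And>f. f \<in> continuous_dual s X \<Longrightarrow> \<exists>K. \<forall>y\<in>D. norm (f y) \<le> K"
  shows "bounded_in s X D"
  unfolding bounded_in_def
proof (intro conjI allI impI D)
  note vs = lcs_vector_space[OF lcs] lcs_subspace[OF lcs]
  fix U assume "0 \<in> X interior_of U"
  then obtain A where A: "absolutely_convex s A" "0 \<in> X interior_of A" "A \<subseteq> U"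
    by (rule lcs_absolutely_convex_nbhd[OF lcs])
  note ab = lcs_nbhd_absorbs_points[OF lcs A(2)]
  interpret vector_space s by (rule vs(1))
  have le1: "gauge_of s A x \<le> 1" if "x \<in> A" for x using gauge_of_le[of 1 s x A] that by simp
  have "\<exists>K. \<forall>y\<in>D. norm (f y) \<le> K"
    if f: "linear_map_on s (*) (topspace X) f" "\<And>x. x \<in> topspace X \<Longrightarrow> norm (f x) \<le> 2 * gauge_of s A x" for f
  proof -
    have "norm (f x) \<le> 2" if "x \<in> topspace X" "x \<in> A" for x using f(2)[OF that(1)] le1[OF that(2)] by simp
    then obtain g where "g \<in> continuous_dual s X" "\<And>x. x \<in> topspace X \<Longrightarrow> g x = f x"
      using lcs_extend_to_dual[OF lcs f(1) A(2)] by metis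
    then show ?thesis using wb[of g] D by (metis subsetD)
  qed
  then obtain R where R: "\<And>y. y \<in> D \<Longrightarrow> gauge_of s A y \<le> R"
    using uniform_boundedness_seminorm[OF vs seminorm_on_gauge_of[OF vs A(1) ab] D] by blast
  define t where "t = \<bar>R\<bar> + 1"
  have "absorbs s A D"
  proof (rule absorbs_absolutely_convex[OF vs(1) A(1)])
    show "t > 0" by (simp add: t_def)
    fix y assume y: "y \<in> D"
    then have "gauge_of s A y < t" using R[OF y] by (simp add: t_def)
    then show "s (of_real (1 / t)) y \<in> A" using gauge_of_less(2)[OF vs(1) A(1) ab] D y by blast
  qed
  then show "absorbs s U D" using A(3) by (rule absorbs_mono)
qed

section \<open>The strong dual\<close>

lemma closure_of_sequence_metrizable:
  assumes "metrizable_space X" "x \<in> X closure_of M"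
  obtains z where "\<And>n::nat. z n \<in> M" "limitin X z x sequentially"
proof -
  obtain S d where S: "Metric_space S d" and X: "X = Metric_space.mtopology S d"
    using assms(1) unfolding metrizable_space_def by blast
  obtain z where "range z \<subseteq> M \<inter> S" "limitin X z x sequentially"
    using assms(2) unfolding X Metric_space.closure_of_sequentially[OF S] by blast
  then show thesis using that by blast
qed

lemma vector_space_fun_scale: "vector_space fun_scale"
  by unfold_locales (auto simp: fun_scale_def fun_eq_iff algebra_simps)

lemma fun_scale_apply: "fun_scale c f x = c * f x"
  by (simp add: fun_scale_def)

lemma linear_map_on_dual:
  "f \<in> continuous_dual s X \<Longrightarrow> linear_map_on s (*) (topspace X) f"
  by (simp add: continuous_dual_def)

lemma subspace_continuous_dual:
  fixes s :: "'k::{real_normed_field, euclidean_space} \<Rightarrow> 'a::ab_group_add \<Rightarrow> 'a"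
  shows "module.subspace fun_scale (continuous_dual s X)"
proof -
  interpret vector_space "fun_scale :: 'k \<Rightarrow> ('a \<Rightarrow> 'k) \<Rightarrow> 'a \<Rightarrow> 'k" by (rule vector_space_fun_scale)
  show ?thesis
  proof (rule subspaceI)
    show "0 \<in> continuous_dual s X"
      by (simp add: continuous_dual_def linear_map_on_def zero_fun_def)
    fix f g assume f: "f \<in> continuous_dual s X" and g: "g \<in> continuous_dual s X"
    have "continuous_map X euclidean (\<lambda>x. f x + g x)"
      using f g by (intro continuous_map_add) (auto simp: continuous_dual_def)
    then show "f + g \<in> continuous_dual s X"
      using f g by (simp add: continuous_dual_def linear_map_on_def plus_fun_def algebra_simps)
  next
    fix c :: 'k and f assume f: "f \<in> continuous_dual s X"
    have "continuous_map euclidean euclidean (\<lambda>y. c * y)"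
      using continuous_on_mult_left[OF continuous_on_id] by simp
    moreover have "continuous_map X euclidean f" using f by (simp add: continuous_dual_def)
    ultimately have "continuous_map X euclidean ((\<lambda>y. c * y) \<circ> f)"
      using continuous_map_compose by blast
    then show "fun_scale c f \<in> continuous_dual s X"
      using f by (simp add: continuous_dual_def linear_map_on_def fun_scale_def algebra_simps o_def)
  qed
qed

definition polar_in ::
  "('k::{real_normed_field, euclidean_space} \<Rightarrow> 'a::ab_group_add \<Rightarrow> 'a) \<Rightarrow> 'a topology \<Rightarrow> 'a set \<Rightarrow> ('a \<Rightarrow> 'k) set"
  where "polar_in s X B = {f \<in> continuous_dual s X. \<forall>x\<in>B. norm (f x) \<le> 1}"

lemma absolutely_convex_polar_in: "absolutely_convex fun_scale (polar_in s X B)"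
  unfolding absolutely_convex_def
proof (intro ballI allI impI)
  interpret vector_space "fun_scale :: 'a \<Rightarrow> ('b \<Rightarrow> 'a) \<Rightarrow> 'b \<Rightarrow> 'a" by (rule vector_space_fun_scale)
  fix f g and a b :: 'a
  assume f: "f \<in> polar_in s X B" and g: "g \<in> polar_in s X B" and ab: "norm a + norm b \<le> 1"
  have "norm (a * f x + b * g x) \<le> 1" if x: "x \<in> B" for x
  proof -
    have "norm (a * f x + b * g x) \<le> norm a * norm (f x) + norm b * norm (g x)"
      using norm_triangle_ineq[of "a * f x" "b * g x"] by (simp add: norm_mult)
    also have "\<dots> \<le> norm a * 1 + norm b * 1"
      using f g x by (intro add_mono mult_left_mono) (auto simp: polar_in_def)
    finally show ?thesis using ab by simp
  qed
  moreover have "fun_scale a f + fun_scale b g \<in> continuous_dual s X"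
    using f g subspace_add[OF subspace_continuous_dual] subspace_scale[OF subspace_continuous_dual]
    by (auto simp: polar_in_def)
  ultimately show "fun_scale a f + fun_scale b g \<in> polar_in s X B"
    by (simp add: polar_in_def fun_scale_apply)
qed

lemma polar_in_absorbs_points:
  assumes "locally_convex_space s X" "bounded_in s X B" "f \<in> continuous_dual s X"
  shows "\<exists>t>0. fun_scale (of_real (1 / t)) f \<in> polar_in s X B"
proof -
  interpret vector_space "fun_scale :: 'a \<Rightarrow> ('b \<Rightarrow> 'a) \<Rightarrow> 'b \<Rightarrow> 'a" by (rule vector_space_fun_scale)
  obtain K where K: "K > 0" "\<And>x. x \<in> B \<Longrightarrow> norm (f x) \<le> K"
    using bounded_functional_on_bounded[OF assms(1,3,2)] by blast
  have "norm (of_real (1 / K) * f x) \<le> 1" if "x \<in> B" for x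
    unfolding norm_mult norm_of_real using K(1) K(2)[OF that] by (simp add: divide_le_eq)
  then have "fun_scale (of_real (1 / K)) f \<in> polar_in s X B"
    using subspace_scale[OF subspace_continuous_dual assms(3)] by (simp add: polar_in_def fun_scale_apply)
  then show ?thesis using K(1) by blast
qed

lemma continuous_map_strong_dual:
  assumes lin: "linear_map_on fun_scale (*) (continuous_dual s X) \<phi>" and B: "bounded_in s X B"
    and K: "\<And>f. f \<in> polar_in s X B \<Longrightarrow> norm (\<phi> f) \<le> K"
  shows "continuous_map (strong_dual s X) euclidean \<phi>"
  unfolding continuous_map_def
proof (intro conjI allI impI)
  interpret vector_space "fun_scale :: 'a \<Rightarrow> ('b \<Rightarrow> 'a) \<Rightarrow> 'b \<Rightarrow> 'a" by (rule vector_space_fun_scale)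
  note sub = subspace_continuous_dual[of s X]
  fix S :: "'a set" assume "openin euclidean S"
  then have S: "open S" by (simp add: open_openin[symmetric])
  have "\<exists>B e. bounded_in s X B \<and> 0 < e \<and>
      {g \<in> continuous_dual s X. \<forall>x\<in>B. norm (g x - f x) < e} \<subseteq> {f \<in> continuous_dual s X. \<phi> f \<in> S}"
    if f: "f \<in> continuous_dual s X" "\<phi> f \<in> S" for f
  proof -
    obtain e where e: "e > 0" "ball (\<phi> f) e \<subseteq> S" using S f(2) open_contains_ball by blast
    define d where "d = e / (\<bar>K\<bar> + 1)"
    have d: "d > 0" "d * \<bar>K\<bar> < e" using e(1) by (auto simp: d_def divide_less_eq algebra_simps)
    have "\<phi> g \<in> S" if g: "g \<in> continuous_dual s X" "\<forall>x\<in>B. norm (g x - f x) < d" for g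
    proof -
      have gf: "g - f \<in> continuous_dual s X" using subspace_diff[OF sub g(1) f(1)] .
      have "norm (of_real (1 / d) * (g x - f x)) \<le> 1" if "x \<in> B" for x
        unfolding norm_mult norm_of_real using d(1) g(2) that by (simp add: divide_le_eq less_imp_le)
      then have "fun_scale (of_real (1 / d)) (g - f) \<in> polar_in s X B"
        using subspace_scale[OF sub gf] by (simp add: polar_in_def fun_scale_apply)
      then have "norm (\<phi> (fun_scale (of_real (1 / d)) (g - f))) \<le> K" by (rule K)
      moreover have "\<phi> (fun_scale (of_real (1 / d)) (g - f)) = of_real (1 / d) * \<phi> (g - f)"
        using lin gf unfolding linear_map_on_def by blast
      moreover have "\<phi> (g - f) = \<phi> g - \<phi> f"
        by (rule linear_map_on_diff[OF vector_space_fun_scale sub lin g(1) f(1)])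
      ultimately have "norm (of_real (1 / d) * (\<phi> g - \<phi> f)) \<le> K" by (simp only:)
      then have "norm (\<phi> g - \<phi> f) \<le> d * K"
        unfolding norm_mult norm_of_real using d(1) by (simp add: divide_le_eq mult.commute)
      also have "\<dots> \<le> d * \<bar>K\<bar>" using d(1) by simp
      finally have "\<phi> g \<in> ball (\<phi> f) e" using d(2) by (simp add: dist_norm norm_minus_commute)
      then show ?thesis using e(2) by blast
    qed
    then show ?thesis using B d(1) by blast
  qed
  then show "openin (strong_dual s X) {f \<in> topspace (strong_dual s X). \<phi> f \<in> S}"
    unfolding openin_strong_dual topspace_strong_dual by blast
qed auto

text \<open>
  The form in which semi-reflexivity is used: functionals on the dual bounded on the polar of a
  bounded set are point evaluations.
\<close>

lemma semi_reflexive_representation: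
  assumes sr: "semi_reflexive s X"
    and lin: "linear_map_on fun_scale (*) (continuous_dual s X) \<phi>" and B: "bounded_in s X B"
    and K: "\<And>f. f \<in> polar_in s X B \<Longrightarrow> norm (\<phi> f) \<le> K"
  obtains x where "x \<in> topspace X" "\<And>f. f \<in> continuous_dual s X \<Longrightarrow> \<phi> f = f x"
proof -
  interpret vector_space "fun_scale :: 'a \<Rightarrow> ('b \<Rightarrow> 'a) \<Rightarrow> 'b \<Rightarrow> 'a" by (rule vector_space_fun_scale)
  note sub = subspace_continuous_dual[of s X]
  let ?\<psi> = "\<lambda>f. if f \<in> continuous_dual s X then \<phi> f else 0"
  have "continuous_map (strong_dual s X) euclidean ?\<psi>"
    using continuous_map_strong_dual[OF lin B K] by (rule continuous_map_eq) auto
  moreover have "linear_map_on fun_scale (*) (continuous_dual s X) ?\<psi>"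
    using lin subspace_add[OF sub] subspace_scale[OF sub] by (simp add: linear_map_on_def)
  ultimately have "?\<psi> \<in> continuous_dual fun_scale (strong_dual s X)"
    by (simp add: continuous_dual_def[of fun_scale])
  then obtain x where x: "x \<in> topspace X" "?\<psi> = canonical_map s X x"
    using sr unfolding semi_reflexive_def by blast
  have "\<phi> f = f x" if "f \<in> continuous_dual s X" for f
    using fun_cong[OF x(2), of f] that by (simp add: canonical_map_def)
  then show thesis using that x(1) by blast
qed

section \<open>Operators between strong duals\<close>

context
  fixes sE :: "'k::{real_normed_field, euclidean_space} \<Rightarrow> 'a::ab_group_add \<Rightarrow> 'a"
    and E :: "'a topology"
    and sF :: "'k \<Rightarrow> 'b::ab_group_add \<Rightarrow> 'b"
    and F :: "'b topology"
    and T :: "('a \<Rightarrow> 'k) \<Rightarrow> ('b \<Rightarrow> 'k)"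
  assumes lcsE: "locally_convex_space sE E" and srE: "semi_reflexive sE E"
    and metE: "metrizable_space E"
    and lcsF: "locally_convex_space sF F" and srF: "semi_reflexive sF F"
    and lin: "linear_map_on fun_scale fun_scale (continuous_dual sE E) T"
    and cont: "continuous_map (strong_dual sE E) (strong_dual sF F) T"
    and onto: "T ` continuous_dual sE E = continuous_dual sF F"
begin

interpretation dE: vector_space "fun_scale :: 'k \<Rightarrow> ('a \<Rightarrow> 'k) \<Rightarrow> 'a \<Rightarrow> 'k"
  by (rule vector_space_fun_scale)
interpretation dF: vector_space "fun_scale :: 'k \<Rightarrow> ('b \<Rightarrow> 'k) \<Rightarrow> 'b \<Rightarrow> 'k"
  by (rule vector_space_fun_scale)

lemmas dual_closed_E =
  dE.subspace_0[OF subspace_continuous_dual[of sE E]]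
  dE.subspace_add[OF subspace_continuous_dual[of sE E]]
  dE.subspace_scale[OF subspace_continuous_dual[of sE E]]
  dE.subspace_diff[OF subspace_continuous_dual[of sE E]]

lemmas dual_closed_F =
  dF.subspace_scale[OF subspace_continuous_dual[of sF F]]
  dF.subspace_diff[OF subspace_continuous_dual[of sF F]]

lemma T_in_dual: "f \<in> continuous_dual sE E \<Longrightarrow> T f \<in> continuous_dual sF F"
  using onto by blast

lemma T_linear:
  "f \<in> continuous_dual sE E \<Longrightarrow> g \<in> continuous_dual sE E \<Longrightarrow> T (f + g) = T f + T g"
  "f \<in> continuous_dual sE E \<Longrightarrow> T (fun_scale c f) = fun_scale c (T f)"
  using lin by (auto simp: linear_map_on_def)

lemma T_zero: "T 0 = 0"
  using T_linear(2)[OF dual_closed_E(1), of 0] by simp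

text \<open>
  The transpose of \<open>T\<close> maps \<open>F\<close> into \<open>E\<close>: the functional \<open>f \<mapsto> T f y\<close> on \<open>E\<^sup>*\<close> is continuous, so it is
  evaluation at a point.
\<close>

lemma transpose_point:
  assumes y: "y \<in> topspace F"
  obtains z where "z \<in> topspace E" "\<And>f. f \<in> continuous_dual sE E \<Longrightarrow> f z = T f y"
proof -
  have by1: "bounded_in sF F {y}"
    using y by (intro weakly_bounded_imp_bounded_in[OF lcsF]) auto
  have ly: "linear_map_on fun_scale (*) (continuous_dual sF F) (\<lambda>h. h y)"
    by (simp add: linear_map_on_def fun_scale_apply)
  have "continuous_map (strong_dual sF F) euclidean (\<lambda>h. h y)"
    by (rule continuous_map_strong_dual[OF ly by1, of 1]) (simp add: polar_in_def)
  from continuous_map_compose[OF cont this]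
  have c: "continuous_map (strong_dual sE E) euclidean (\<lambda>f. T f y)" by (simp add: o_def)
  have "openin (strong_dual sE E) {f \<in> topspace (strong_dual sE E). T f y \<in> ball 0 1}"
    by (rule openin_continuous_map_preimage[OF c]) simp
  moreover have "0 \<in> {f \<in> topspace (strong_dual sE E). T f y \<in> ball 0 1}"
    using dual_closed_E(1) T_zero by simp
  ultimately obtain B e where B: "bounded_in sE E B" and e: "e > 0"
    and sub: "{g \<in> continuous_dual sE E. \<forall>x\<in>B. norm (g x - 0 x) < e}
      \<subseteq> {f \<in> topspace (strong_dual sE E). T f y \<in> ball 0 1}"
    unfolding openin_strong_dual by meson
  have "norm (T f y) \<le> 2 / e" if f: "f \<in> polar_in sE E B" for f
  proof -
    have fE: "f \<in> continuous_dual sE E" using f by (simp add: polar_in_def)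
    have "norm (of_real (e / 2) * f x) < e" if "x \<in> B" for x
    proof -
      have "norm (of_real (e / 2) * f x) \<le> e / 2 * 1"
        unfolding norm_mult norm_of_real using e f that by (intro mult_mono) (auto simp: polar_in_def)
      then show ?thesis using e by linarith
    qed
    then have "fun_scale (of_real (e / 2)) f \<in> {f \<in> topspace (strong_dual sE E). T f y \<in> ball 0 1}"
      using dual_closed_E(3)[OF fE] by (intro subsetD[OF sub]) (simp add: fun_scale_apply)
    then have "norm (of_real (e / 2) * T f y) < 1"
      using T_linear(2)[OF fE, of "of_real (e / 2)"] by (simp add: fun_scale_apply)
    then show ?thesis
      unfolding norm_mult norm_of_real using e by (simp add: field_simps)
  qed
  moreover have "linear_map_on fun_scale (*) (continuous_dual sE E) (\<lambda>f. T f y)"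
    using T_linear by (simp add: linear_map_on_def fun_scale_apply)
  ultimately obtain z where "z \<in> topspace E" "\<And>f. f \<in> continuous_dual sE E \<Longrightarrow> T f y = f z"
    using semi_reflexive_representation[OF srE _ B] by blast
  then show thesis using that by force
qed

text \<open>
  The transpose of \<open>T\<close> has closed range \<open>M\<close>. By Hahn-Banach \<open>x\<close> lies in the closure of \<open>M\<close>, since
  a functional that vanishes on \<open>M\<close> is in the kernel of \<open>T\<close>. Along a sequence in \<open>M\<close> that tends
  to \<open>x\<close>, the preimages in \<open>F\<close> form a bounded set, whose polar bounds \<open>T f \<mapsto> f x\<close>.
\<close>

lemma annihilator_kernel_in_transpose_range:
  assumes x: "x \<in> topspace E"
    and ann: "\<And>f. f \<in> continuous_dual sE E \<Longrightarrow> T f = 0 \<Longrightarrow> f x = 0"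
  obtains y where "y \<in> topspace F" "\<And>f. f \<in> continuous_dual sE E \<Longrightarrow> f x = T f y"
proof -
  interpret vE: vector_space sE by (rule lcs_vector_space[OF lcsE])
  define M where "M = {z \<in> topspace E. \<exists>y\<in>topspace F. \<forall>f\<in>continuous_dual sE E. f z = T f y}"
  have zero: "f 0 = 0" if "f \<in> continuous_dual sE E" for f
    by (rule linear_map_on_zero[OF lcs_vector_space[OF lcsE] lcs_subspace[OF lcsE] linear_map_on_dual[OF that]])
  have zeroF: "g 0 = 0" if "g \<in> continuous_dual sF F" for g
    by (rule linear_map_on_zero[OF lcs_vector_space[OF lcsF] lcs_subspace[OF lcsF] linear_map_on_dual[OF that]])
  have M: "module.subspace sE M"
  proof (rule vE.subspaceI)
    show "0 \<in> M"
      using lcs_topspace(1)[OF lcsE] lcs_topspace(1)[OF lcsF] zero zeroF T_in_dual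
      by (fastforce simp: M_def)
    fix u v assume "u \<in> M" "v \<in> M"
    then obtain a b where u: "u \<in> topspace E" "a \<in> topspace F" "\<forall>f\<in>continuous_dual sE E. f u = T f a"
      and v: "v \<in> topspace E" "b \<in> topspace F" "\<forall>f\<in>continuous_dual sE E. f v = T f b"
      unfolding M_def by blast
    have "f (u + v) = T f (a + b)" if f: "f \<in> continuous_dual sE E" for f
      using linear_map_on_dual[OF f] linear_map_on_dual[OF T_in_dual[OF f]] u v f
      by (simp add: linear_map_on_def)
    then show "u + v \<in> M"
      using lcs_topspace(2)[OF lcsE u(1) v(1)] lcs_topspace(2)[OF lcsF u(2) v(2)]
      unfolding M_def by blast
  next
    fix c u assume "u \<in> M"
    then obtain a where u: "u \<in> topspace E" "a \<in> topspace F" "\<forall>f\<in>continuous_dual sE E. f u = T f a"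
      unfolding M_def by blast
    have "f (sE c u) = T f (sF c a)" if f: "f \<in> continuous_dual sE E" for f
      using linear_map_on_dual[OF f] linear_map_on_dual[OF T_in_dual[OF f]] u f
      by (simp add: linear_map_on_def)
    then show "sE c u \<in> M"
      using lcs_topspace(3)[OF lcsE u(1)] lcs_topspace(3)[OF lcsF u(2)]
      unfolding M_def by blast
  qed
  have "x \<in> E closure_of M"
  proof (rule ccontr)
    assume "x \<notin> E closure_of M"
    moreover have "M \<subseteq> topspace E" by (auto simp: M_def)
    ultimately obtain f where f: "f \<in> continuous_dual sE E" "\<And>z. z \<in> M \<Longrightarrow> f z = 0" "f x \<noteq> 0"
      using lcs_separation_subspace[OF lcsE M _ x] by blast
    have "T f y = 0" for y
    proof (cases "y \<in> topspace F")
      case True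
      then obtain z where z: "z \<in> topspace E" "\<And>f. f \<in> continuous_dual sE E \<Longrightarrow> f z = T f y"
        using transpose_point by blast
      then have "z \<in> M" using True by (auto simp: M_def)
      then show ?thesis using f(1,2) z(2) by metis
    next
      case False
      then show ?thesis using T_in_dual[OF f(1)] by (simp add: continuous_dual_def)
    qed
    then have "T f = 0" by (simp add: fun_eq_iff)
    then show False using ann f(1,3) by blast
  qed
  then obtain z where zM: "\<And>n. z n \<in> M" and lim: "limitin E z x sequentially"
    using closure_of_sequence_metrizable[OF metE] by blast
  have conv: "(\<lambda>n. f (z n)) \<longlonglongrightarrow> f x" if "f \<in> continuous_dual sE E" for f
  proof -
    have "continuous_map E euclidean f" using that by (simp add: continuous_dual_def)
    from continuous_map_limit[OF this lim] show ?thesis by (simp add: o_def)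
  qed
  have "\<forall>n. \<exists>y\<in>topspace F. \<forall>f\<in>continuous_dual sE E. f (z n) = T f y"
    using zM by (auto simp: M_def)
  then obtain y where yF: "\<And>n. y n \<in> topspace F"
    and y: "\<And>n f. f \<in> continuous_dual sE E \<Longrightarrow> f (z n) = T f (y n)"
    by metis
  have bnd: "bounded_in sF F (range y)"
  proof (rule weakly_bounded_imp_bounded_in[OF lcsF])
    show "range y \<subseteq> topspace F" using yF by blast
    fix g assume "g \<in> continuous_dual sF F"
    then obtain f where f: "f \<in> continuous_dual sE E" "g = T f" using onto by blast
    have "Bseq (\<lambda>n. f (z n))" using conv[OF f(1)] by (rule convergent_imp_Bseq[OF convergentI])
    then show "\<exists>K. \<forall>v\<in>range y. norm (g v) \<le> K"
      using y[OF f(1)] f(2) by (auto simp: Bseq_def)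
  qed
  \<comment> \<open>Any preimage of \<open>g\<close> gives the same value, since \<open>x\<close> is annihilated by the kernel.\<close>
  define \<psi> where "\<psi> g = inv_into (continuous_dual sE E) T g x" for g
  have \<psi>: "\<psi> (T f) = f x" if f: "f \<in> continuous_dual sE E" for f
  proof -
    let ?h = "inv_into (continuous_dual sE E) T (T f)"
    have h: "?h \<in> continuous_dual sE E" "T ?h = T f"
      using inv_into_into[OF imageI[OF f]] f_inv_into_f[OF imageI[OF f]] by auto
    note d = dual_closed_E(4)[OF f h(1)]
    have "T f = T (f - ?h) + T ?h" using T_linear(1)[OF d h(1)] by simp
    then have "T (f - ?h) = 0" using h(2) by simp
    then have "(f - ?h) x = 0" by (rule ann[OF d])
    then show ?thesis by (simp add: \<psi>_def)
  qed
  have "linear_map_on fun_scale (*) (continuous_dual sF F) \<psi>"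
    unfolding linear_map_on_def
  proof (intro conjI ballI allI)
    fix g h assume "g \<in> continuous_dual sF F" "h \<in> continuous_dual sF F"
    then obtain f k where fk: "f \<in> continuous_dual sE E" "g = T f" "k \<in> continuous_dual sE E" "h = T k"
      using onto by blast
    then show "\<psi> (g + h) = \<psi> g + \<psi> h"
      using \<psi>[OF dual_closed_E(2)[OF fk(1,3)]] T_linear(1)[OF fk(1,3)] \<psi> by simp
  next
    fix c g assume "g \<in> continuous_dual sF F"
    then obtain f where f: "f \<in> continuous_dual sE E" "g = T f" using onto by blast
    then show "\<psi> (fun_scale c g) = c * \<psi> g"
      using \<psi>[OF dual_closed_E(3)[OF f(1)]] T_linear(2)[OF f(1)] \<psi> by (simp add: fun_scale_apply)
  qed
  moreover have "norm (\<psi> g) \<le> 1" if g: "g \<in> polar_in sF F (range y)" for g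
  proof -
    have "g \<in> continuous_dual sF F" using g by (simp add: polar_in_def)
  then obtain f where f: "f \<in> continuous_dual sE E" "g = T f" using onto by blast
    have "norm (f (z n)) \<le> 1" for n using g f y by (simp add: polar_in_def)
    then have "norm (f x) \<le> 1"
      using Lim_norm_ubound[OF _ conv[OF f(1)]] by (simp add: trivial_limit_sequentially)
    then show ?thesis using \<psi> f by simp
  qed
  ultimately obtain v where "v \<in> topspace F" "\<And>g. g \<in> continuous_dual sF F \<Longrightarrow> \<psi> g = g v"
    using semi_reflexive_representation[OF srF _ bnd] by blast
  then show thesis using that \<psi> T_in_dual by metis
qed

text \<open>
  The set is the preimage of the bipolar of \<open>B\<close> under the transpose. It is weakly bounded because
  each functional on \<open>F\<close> is \<open>T f\<close> for some \<open>f\<close>, and the polar of \<open>B\<close> absorbs \<open>f\<close>.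
\<close>

lemma bounded_transpose_preimage:
  assumes B: "bounded_in sE E B"
  shows "bounded_in sF F {y \<in> topspace F. \<forall>f\<in>polar_in sE E B. norm (T f y) \<le> 1}"
proof (rule weakly_bounded_imp_bounded_in[OF lcsF])
  fix g assume "g \<in> continuous_dual sF F"
  then obtain f where f: "f \<in> continuous_dual sE E" "g = T f" using onto by blast
  obtain t where t: "t > 0" "fun_scale (of_real (1 / t)) f \<in> polar_in sE E B"
    using polar_in_absorbs_points[OF lcsE B f(1)] by blast
  have "norm (g y) \<le> t" if "\<forall>f\<in>polar_in sE E B. norm (T f y) \<le> 1" for y
  proof -
    have "norm (T (fun_scale (of_real (1 / t)) f) y) \<le> 1" using that t(2) by blast
    then have "norm (of_real (1 / t) * g y) \<le> 1"
      by (simp only: T_linear(2)[OF f(1)] f(2) fun_scale_apply)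
    then show ?thesis unfolding norm_mult norm_of_real using t(1) by (simp add: divide_le_eq)
  qed
  then show "\<exists>K. \<forall>y\<in>{y \<in> topspace F. \<forall>f\<in>polar_in sE E B. norm (T f y) \<le> 1}. norm (g y) \<le> K"
    by blast
qed auto

text \<open>
  A functional on \<open>E\<^sup>*\<close> that separates half a preimage of \<open>g\<close> from \<open>ker T + P\<close>, with \<open>P\<close> the polar of
  \<open>B\<close>, is evaluation at a point that comes from \<open>F\<close>; that point lies in the set on which \<open>g\<close> is
  bounded by \<open>1\<close>, whereas the separation makes \<open>g\<close> at least \<open>2\<close> there. The factor \<open>1 / 2\<close> is what
  turns separation with weak inequalities into a contradiction.
\<close>

lemma polar_lift:
  assumes B: "bounded_in sE E B"
    and g: "g \<in> polar_in sF F {y \<in> topspace F. \<forall>f\<in>polar_in sE E B. norm (T f y) \<le> 1}"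
  obtains b where "b \<in> polar_in sE E B" "T b = fun_scale (1 / 2) g"
proof -
  let ?P = "polar_in sE E B"
  let ?N = "{f \<in> continuous_dual sE E. T f = 0}"
  let ?W = "{k + b | k b. k \<in> ?N \<and> b \<in> ?P}"
  have "g \<in> continuous_dual sF F" using g by (simp add: polar_in_def)
  then obtain f where f: "f \<in> continuous_dual sE E" "g = T f" using onto by blast
  have N: "module.subspace fun_scale ?N"
    by (rule dE.subspaceI) (auto simp: dual_closed_E T_linear T_zero)
  have W: "absolutely_convex fun_scale ?W"
    by (rule absolutely_convex_sum[OF vector_space_fun_scale
        absolutely_convex_subspace[OF vector_space_fun_scale N] absolutely_convex_polar_in])
  have PW: "?P \<subseteq> ?W" using dE.subspace_0[OF N] by force
  have P0: "0 \<in> ?P" using dual_closed_E(1) by (simp add: polar_in_def)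
  have NW: "?N \<subseteq> ?W"
  proof
    fix k assume "k \<in> ?N"
    then have "k + 0 \<in> ?W" using P0 by blast
    then show "k \<in> ?W" by simp
  qed
  have ab: "\<exists>t>0. fun_scale (of_real (1 / t)) h \<in> ?W" if "h \<in> continuous_dual sE E" for h
    using polar_in_absorbs_points[OF lcsE B that] PW by blast
  have f2: "fun_scale (1 / 2) f \<in> continuous_dual sE E" by (rule dual_closed_E(3)[OF f(1)])
  have "fun_scale (1 / 2) f \<in> ?W"
  proof (rule ccontr)
    assume nW: "fun_scale (1 / 2) f \<notin> ?W"
    obtain \<phi> where \<phi>: "linear_map_on fun_scale (*) (continuous_dual sE E) \<phi>"
      "\<And>h. h \<in> continuous_dual sE E \<Longrightarrow> h \<in> ?W \<Longrightarrow> norm (\<phi> h) \<le> 1"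
      "norm (\<phi> (fun_scale (1 / 2) f)) \<ge> 1"
      using separation_absolutely_convex[OF vector_space_fun_scale subspace_continuous_dual W ab f2 nW] by blast
    have \<phi>P: "norm (\<phi> h) \<le> 1" if "h \<in> ?P" for h
    proof -
      have "h \<in> continuous_dual sE E" using that by (simp add: polar_in_def)
      then show ?thesis by (rule \<phi>(2)[OF _ subsetD[OF PW that]])
    qed
    obtain x where x: "x \<in> topspace E" "\<And>h. h \<in> continuous_dual sE E \<Longrightarrow> \<phi> h = h x"
      using semi_reflexive_representation[OF srE \<phi>(1) B \<phi>P] by blast
    have "h x = 0" if h: "h \<in> continuous_dual sE E" "T h = 0" for h
    proof -
      have bd: "norm (\<phi> k) \<le> 1" if "k \<in> ?N" for k
        by (rule \<phi>(2)[OF _ subsetD[OF NW that]]) (use that in blast)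
      have "\<phi> h = 0"
        by (rule linear_map_on_bounded_subspace[OF vector_space_fun_scale N \<phi>(1) _ bd]) (use h in auto)
      then show ?thesis using x(2) h(1) by simp
    qed
    then obtain y where y: "y \<in> topspace F" "\<And>h. h \<in> continuous_dual sE E \<Longrightarrow> h x = T h y"
      using annihilator_kernel_in_transpose_range[OF x(1)] by blast
    have "norm (T h y) \<le> 1" if "h \<in> ?P" for h
      using \<phi>P[OF that] x(2)[of h] y(2)[of h] that by (simp add: polar_in_def)
    then have "norm (g y) \<le> 1" using g y(1) by (simp add: polar_in_def)
    moreover have "\<phi> (fun_scale (1 / 2) f) = 1 / 2 * g y"
      using \<phi>(1) f x(2) y(2) by (simp add: linear_map_on_def)
    then have "norm (\<phi> (fun_scale (1 / 2) f)) = 1 / 2 * norm (g y)"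
      by (simp only: norm_mult norm_divide norm_one norm_numeral)
    ultimately show False using \<phi>(3) by simp
  qed
  then obtain k b where kb: "fun_scale (1 / 2) f = k + b" "k \<in> ?N" "b \<in> ?P" by blast
  then have "T (fun_scale (1 / 2) f) = T b"
    using T_linear(1)[of k b] by (simp add: polar_in_def)
  then have "T b = fun_scale (1 / 2) g" using T_linear(2)[OF f(1)] f(2) by simp
  then show thesis using that kb(3) by blast
qed

text \<open>
  By linearity it suffices to lift differences. The radius \<open>e / 4\<close> lifts, with the loss of a factor
  \<open>2\<close> in \<open>polar_lift\<close>, to functionals of size at most \<open>e / 2 < e\<close> on \<open>B\<close>.
\<close>

proposition open_map_semi_reflexive_duals: "open_map (strong_dual sE E) (strong_dual sF F) T"
  unfolding open_map_def
proof (intro allI impI)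
  fix U assume U: "openin (strong_dual sE E) U"
  show "openin (strong_dual sF F) (T ` U)"
    unfolding openin_strong_dual
  proof (intro conjI ballI)
    show "T ` U \<subseteq> continuous_dual sF F" using U T_in_dual by (auto simp: openin_strong_dual)
    fix h0 assume "h0 \<in> T ` U"
    then obtain f where f: "f \<in> U" "h0 = T f" by blast
    have fE: "f \<in> continuous_dual sE E" using U f(1) by (auto simp: openin_strong_dual)
    obtain B e where B: "bounded_in sE E B" and e: "e > 0"
      and sub: "{g \<in> continuous_dual sE E. \<forall>x\<in>B. norm (g x - f x) < e} \<subseteq> U"
      using U f(1) unfolding openin_strong_dual by meson
    let ?D = "{y \<in> topspace F. \<forall>f\<in>polar_in sE E B. norm (T f y) \<le> 1}"
    have "h \<in> T ` U" if h: "h \<in> continuous_dual sF F" "\<forall>y\<in>?D. norm (h y - h0 y) < e / 4" for h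
    proof -
      define g where "g = fun_scale (of_real (4 / e)) (h - h0)"
      have "norm (g y) \<le> 1" if "y \<in> ?D" for y
      proof -
        have "norm (h y - h0 y) < e / 4" using h(2) that by blast
        then show ?thesis
          unfolding g_def fun_scale_apply norm_mult norm_of_real using e by (simp add: field_simps)
      qed
      moreover have "g \<in> continuous_dual sF F"
        unfolding g_def f(2) by (rule dual_closed_F(1)[OF dual_closed_F(2)[OF h(1) T_in_dual[OF fE]]])
      ultimately have "g \<in> polar_in sF F ?D" by (simp add: polar_in_def)
      then obtain b where b: "b \<in> polar_in sE E B" "T b = fun_scale (1 / 2) g"
        using polar_lift[OF B] by blast
      have bE: "b \<in> continuous_dual sE E" using b(1) by (simp add: polar_in_def)
      let ?c = "of_real (e / 2) :: 'k"
      note cb = dual_closed_E(3)[OF bE, of ?c]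
      have "norm (?c * b x) < e" if "x \<in> B" for x
      proof -
        have "norm (?c * b x) \<le> e / 2 * 1"
          unfolding norm_mult norm_of_real using e b(1) that by (intro mult_mono) (auto simp: polar_in_def)
        then show ?thesis using e by linarith
      qed
      then have "f + fun_scale ?c b \<in> U"
        using dual_closed_E(2)[OF fE cb] by (intro subsetD[OF sub]) (simp add: fun_scale_apply)
      moreover have "T (f + fun_scale ?c b) = h"
      proof -
        have "?c * (1 / 2) * of_real (4 / e) = (1 :: 'k)" using e by simp
        then have "fun_scale ?c (T b) = h - h0"
          unfolding b(2) g_def by (simp add: mult.assoc)
        then show ?thesis using T_linear(1)[OF fE cb] T_linear(2)[OF bE] f(2) by simp
      qed
      ultimately show ?thesis by blast
    qed
    then show "\<exists>B e. bounded_in sF F B \<and> 0 < e \<and>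
        {g \<in> continuous_dual sF F. \<forall>x\<in>B. norm (g x - h0 x) < e} \<subseteq> T ` U"
      using bounded_transpose_preimage[OF B] e by (intro exI[of _ ?D] exI[of _ "e / 4"]) auto
  qed
qed

end

lemma reflexive_imp_semi_reflexive: "reflexive s X \<Longrightarrow> semi_reflexive s X"
  unfolding reflexive_def semi_reflexive_def
  by (metis homeomorphic_imp_surjective_map topspace_strong_dual)

theorem theorem3p3:
  fixes sE :: "'k::{real_normed_field, euclidean_space} \<Rightarrow> 'a::ab_group_add \<Rightarrow> 'a"
    and E :: "'a topology"
    and sF :: "'k \<Rightarrow> 'b::ab_group_add \<Rightarrow> 'b"
    and F :: "'b topology"
    and T :: "('a \<Rightarrow> 'k) \<Rightarrow> ('b \<Rightarrow> 'k)"
  assumes "locally_convex_space sE E" and "semi_reflexive sE E"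
    and "metrizable_space E" and "barrelled sE E"
    and "locally_convex_space sF F" and "Hausdorff_space F" and "reflexive sF F"
    and "linear_map_on fun_scale fun_scale (topspace (strong_dual sE E)) T"
    and "continuous_map (strong_dual sE E) (strong_dual sF F) T"
    and "T ` topspace (strong_dual sE E) = topspace (strong_dual sF F)"
  shows "open_map (strong_dual sE E) (strong_dual sF F) T"
  using open_map_semi_reflexive_duals[OF assms(1,2,3,5) reflexive_imp_semi_reflexive[OF assms(7)]]
    assms(8-10) by simp

end
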